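(* Let $V$ be a complete holomorphic vector field on $\mathbb{C}^d$ with $V(0)=0$ which is globally asymptotically stable (with equilibrium point $0$), and let $X(\lambda,z)$, $\lambda\in\mathbb{C}$, $z\in\mathbb{C}^d$, denote its complex-time flow, $X_\lambda:=X(\lambda,\cdot)$. Let $D\subset\mathbb{C}^d$ be a domain containing the origin which is spirallike and circularlike with respect to $V$, i.e. $X_t(D)\subset D$ for all real $t\ge 0$ and $X_{is}(D)\subseteq D$ for all $s\in(-\pi/2,\pi/2)$. Then the following are equivalent: (1) $D$ is bounded; (2) $D$ is biholomorphic to a bounded domain; (3) $D$ is Kobayashi hyperbolic; (4) the core $\mathfrak{c}(D)$ of $D$ is empty; (5) $D$ is Carathéodory hyperbolic.
   Context: A holomorphic vector field on $\mathbb{C}^d$ is identified with a holomorphic map $\widetilde V=(v_1,\dots,v_d):\mathbb{C}^d\to\mathbb{C}^d$; its flow is given by solutions of the holomorphic ODE $\dot x(\lambda)=\widetilde V(x(\lambda))$, $x(0)=z_0$, with complex time $\lambda$. $V$ is complete if the solution exists for all $z_0\in\mathbb{C}^d$ and all real times (it then exists for all complex times $\lambda$, and $X_{\lambda+\mu}=X_\lambda\circ X_\mu$). The origin (with $V(0)=0$) is globally asymptotically stable if for every $\varepsilon>0$ there is $\delta>0$ with $X_t(B(0,\delta))\subset B(0,\varepsilon)$ for all real $t\ge0$, and $\lim_{t\to+\infty}X(t,z)=0$ for every $z\in\mathbb{C}^d$; a complete vector field with such an equilibrium is called globally asymptotically stable. A domain $D$ is Kobayashi (resp. Carathéodory) hyperbolic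 if its Kobayashi (resp. Carathéodory) pseudo-distance is a distance. The core of a domain $D$ is $\mathfrak{c}(D):=\{\zeta\in D:$ every continuous plurisubharmonic function on $D$ that is bounded from above fails to be strictly plurisubharmonic at $\zeta\}$. *)

theory Defs
  imports "HOL-Analysis.Analysis"
begin

text \<open>Holomorphy of a scalar function of several complex variables: complex
  (Frechet) differentiability, i.e. a real derivative which is complex-linear.\<close>
definition holo_fun_on :: "(complex ^ 'n \<Rightarrow> complex) \<Rightarrow> (complex ^ 'n) set \<Rightarrow> bool" where
  "holo_fun_on f S \<longleftrightarrow>
     (\<forall>z\<in>S. \<exists>L. (f has_derivative L) (at z) \<and> (\<forall>c w. L (c *s w) = c * L w))"

definition holo_map_on :: "(complex ^ 'n \<Rightarrow> complex ^ 'm) \<Rightarrow> (complex ^ 'n) set \<Rightarrow> bool" where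
  "holo_map_on F S \<longleftrightarrow> (\<forall>i. holo_fun_on (\<lambda>z. F z $ i) S)"

definition holo_disc :: "(complex \<Rightarrow> complex ^ 'n) \<Rightarrow> bool" where
  "holo_disc \<phi> \<longleftrightarrow> (\<forall>i. (\<lambda>\<zeta>. \<phi> \<zeta> $ i) holomorphic_on ball 0 1)"

definition domain :: "(complex ^ 'n) set \<Rightarrow> bool" where
  "domain D \<longleftrightarrow> open D \<and> connected D \<and> D \<noteq> {}"

definition poincare :: "complex \<Rightarrow> complex \<Rightarrow> real" where
  "poincare a b = artanh (cmod ((a - b) / (1 - cnj b * a)))"

definition lempert :: "(complex ^ 'n) set \<Rightarrow> complex ^ 'n \<Rightarrow> complex ^ 'n \<Rightarrow> real" where
  "lempert D z w = Inf {poincare 0 t | t \<phi>. t \<in> ball 0 1 \<and> holo_disc \<phi> \<and>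
       \<phi> ` ball 0 1 \<subseteq> D \<and> \<phi> 0 = z \<and> \<phi> t = w}"

definition kobayashi :: "(complex ^ 'n) set \<Rightarrow> complex ^ 'n \<Rightarrow> complex ^ 'n \<Rightarrow> real" where
  "kobayashi D z w = Inf {(\<Sum>j<n. lempert D (p j) (p (Suc j))) | n p.
       p 0 = z \<and> p n = w \<and> (\<forall>j\<le>n. p j \<in> D)}"

definition kobayashi_hyperbolic :: "(complex ^ 'n) set \<Rightarrow> bool" where
  "kobayashi_hyperbolic D \<longleftrightarrow> (\<forall>z\<in>D. \<forall>w\<in>D. kobayashi D z w = 0 \<longrightarrow> z = w)"

definition caratheodory :: "(complex ^ 'n) set \<Rightarrow> complex ^ 'n \<Rightarrow> complex ^ 'n \<Rightarrow> real" where
  "caratheodory D z w = Sup {poincare (f z) (f w) | f. holo_fun_on f D \<and> f ` D \<subseteq> ball 0 1}"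

definition caratheodory_hyperbolic :: "(complex ^ 'n) set \<Rightarrow> bool" where
  "caratheodory_hyperbolic D \<longleftrightarrow> (\<forall>z\<in>D. \<forall>w\<in>D. caratheodory D z w = 0 \<longrightarrow> z = w)"

definition biholo_to_bounded :: "(complex ^ 'n) set \<Rightarrow> bool" where
  "biholo_to_bounded D \<longleftrightarrow> (\<exists>(F :: complex ^ 'n \<Rightarrow> complex ^ 'n) G \<Omega>.
       domain \<Omega> \<and> bounded \<Omega> \<and> holo_map_on F D \<and> holo_map_on G \<Omega> \<and>
       F ` D = \<Omega> \<and> G ` \<Omega> = D \<and> (\<forall>z\<in>D. G (F z) = z) \<and> (\<forall>w\<in>\<Omega>. F (G w) = w))"

definition subharmonic_on :: "complex set \<Rightarrow> (complex \<Rightarrow> real) \<Rightarrow> bool" where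
  "subharmonic_on U v \<longleftrightarrow> continuous_on U v \<and>
     (\<forall>a\<in>U. \<exists>R>0. \<forall>r. 0 < r \<and> r < R \<longrightarrow>
        v a \<le> integral {0..2*pi} (\<lambda>\<theta>. v (a + of_real r * cis \<theta>)) / (2*pi))"

definition psh_on :: "(complex ^ 'n) set \<Rightarrow> (complex ^ 'n \<Rightarrow> real) \<Rightarrow> bool" where
  "psh_on D u \<longleftrightarrow> continuous_on D u \<and>
     (\<forall>a b. subharmonic_on {\<zeta>. a + \<zeta> *s b \<in> D} (\<lambda>\<zeta>. u (a + \<zeta> *s b)))"

definition strictly_psh_at :: "(complex ^ 'n) set \<Rightarrow> (complex ^ 'n \<Rightarrow> real) \<Rightarrow> complex ^ 'n \<Rightarrow> bool" where
  "strictly_psh_at D u \<zeta> \<longleftrightarrow> (\<exists>U \<epsilon>. open U \<and> \<zeta> \<in> U \<and> U \<subseteq> D \<and> \<epsilon> > 0 \<and>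
       psh_on U (\<lambda>z. u z - \<epsilon> * (norm z)\<^sup>2))"

definition core :: "(complex ^ 'n) set \<Rightarrow> (complex ^ 'n) set" where
  "core D = {\<zeta>\<in>D. \<forall>u. continuous_on D u \<and> psh_on D u \<and> bdd_above (u ` D) \<longrightarrow>
       \<not> strictly_psh_at D u \<zeta>}"

definition complete_vf :: "(complex ^ 'n \<Rightarrow> complex ^ 'n) \<Rightarrow> bool" where
  "complete_vf V \<longleftrightarrow> (\<forall>z0. \<exists>x :: real \<Rightarrow> complex ^ 'n. x 0 = z0 \<and>
       (\<forall>t. (x has_vector_derivative V (x t)) (at t)))"

definition is_complex_flow :: "(complex ^ 'n \<Rightarrow> complex ^ 'n) \<Rightarrow> (complex \<Rightarrow> complex ^ 'n \<Rightarrow> complex ^ 'n) \<Rightarrow> bool" where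
  "is_complex_flow V X \<longleftrightarrow> (\<forall>z. X 0 z = z \<and>
       (\<forall>w. ((\<lambda>\<mu>. X \<mu> z) has_derivative (\<lambda>h. h *s V (X w z))) (at w)))"

definition globally_asymptotically_stable ::
  "(complex ^ 'n \<Rightarrow> complex ^ 'n) \<Rightarrow> (complex \<Rightarrow> complex ^ 'n \<Rightarrow> complex ^ 'n) \<Rightarrow> bool" where
  "globally_asymptotically_stable V X \<longleftrightarrow> V 0 = 0 \<and>
     (\<forall>\<epsilon>>0. \<exists>\<delta>>0. \<forall>t\<ge>0. X (of_real t) ` ball 0 \<delta> \<subseteq> ball 0 \<epsilon>) \<and>
     (\<forall>z. ((\<lambda>t. X (of_real t) z) \<longlongrightarrow> 0) at_top)"

definition spirallike :: "(complex \<Rightarrow> complex ^ 'n \<Rightarrow> complex ^ 'n) \<Rightarrow> (complex ^ 'n) set \<Rightarrow> bool" where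
  "spirallike X D \<longleftrightarrow> (\<forall>t::real. t \<ge> 0 \<longrightarrow> X (of_real t) ` D \<subseteq> D)"

definition circularlike :: "(complex \<Rightarrow> complex ^ 'n \<Rightarrow> complex ^ 'n) \<Rightarrow> (complex ^ 'n) set \<Rightarrow> bool" where
  "circularlike X D \<longleftrightarrow> (\<forall>s::real. -pi/2 < s \<and> s < pi/2 \<longrightarrow> X (\<i> * of_real s) ` D \<subseteq> D)"

end

theory Submission
  imports Defs "HOL-Complex_Analysis.Riemann_Mapping"
begin

text \<open>Suppose \<open>D\<close> is unbounded. Points of \<open>D\<close> tending to infinity are attracted to \<open>0\<close>, hence their
  orbits cross a fixed small sphere, after times tending to infinity. Since \<open>D\<close> is invariant under
  \<open>X \<sigma>\<close> for \<open>Re \<sigma> \<ge> 0\<close>, the crossing points \<open>ws n\<close> are centres of flow discs in \<open>D\<close> whose radii tend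
  to infinity, and by compactness \<open>ws n \<longlonglongrightarrow> w\<close> with \<open>w \<in> D\<close>, \<open>w \<noteq> 0\<close>. Liouville-type estimates on
  these discs show that bounded holomorphic functions and the Kobayashi distance do not
  separate \<open>w\<close> from \<open>X 1 w \<noteq> w\<close>, and a three circles argument shows that \<open>\<sigma> \<mapsto> u (X \<sigma> w)\<close> has a
  local maximum at \<open>0\<close> for every plurisubharmonic \<open>u\<close> bounded above, so that \<open>w\<close> lies in the core.\<close>

section \<open>Holomorphic curves and flows\<close>

text \<open>The full complex orbit of \<open>w\<close> is not known to stay in \<open>D\<close>;
  only the discs at \<open>ws n\<close> are. So every estimate is made on those discs, then
  \<open>n\<close> tends to infinity for a fixed radius, and the radius grows last. The discs exist
  because a crossing point is reached at some time \<open>t\<close> from a point of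
  \<open>D\<close>, and the right half-plane shifted by \<open>- t\<close> contains the disc of
  radius \<open>t\<close> about 0; crossing times cannot stay bounded, since flowing back for a
  bounded time keeps points near \<open>w\<close> in a bounded set. Two obstacles shape the rest.
  \<open>psh_on\<close> tests complex lines only, whereas flow discs are curved, so a maximum
  principle on curves has to be derived from lines. The distances are \<open>Inf\<close> and
  \<open>Sup\<close> of sets of reals, so nonemptiness and bounds must be supplied: a holomorphic
  disc through any two points of a domain makes the Lempert set nonempty and the Caratheodory set
  bounded above. For bounded \<open>D\<close>, scaled coordinates and
  \<open>(norm z)\<^sup>2\<close> suffice.\<close>

lemma norm_vector_smult: "norm (c *s v) = norm c * norm (v :: complex ^ 'n)"
  by (simp add: norm_vec_def norm_mult L2_set_right_distrib)

lemma norm_vec_le_sum: "norm (v :: complex ^ 'n) \<le> (\<Sum>i\<in>UNIV. cmod (v $ i))"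
  by (simp add: norm_vec_def L2_set_le_sum)

lemma bounded_linear_smult_left: "bounded_linear (\<lambda>h. h *s (b :: complex ^ 'n))"
proof (rule bounded_linear_intro)
  show "norm (h *s b) \<le> norm h * norm b" for h
    by (simp add: norm_vector_smult)
qed (simp_all add: vec_eq_iff algebra_simps)

text \<open>Bridge between the vector-valued derivative in \<open>is_complex_flow\<close> and
  one-variable complex analysis, which is applied coordinatewise.\<close>

lemma has_derivative_curve_iff:
  fixes \<phi> :: "complex \<Rightarrow> complex ^ 'n"
  shows "(\<phi> has_derivative (\<lambda>h. h *s b)) (at \<zeta>) \<longleftrightarrow>
    (\<forall>i. ((\<lambda>\<zeta>. \<phi> \<zeta> $ i) has_field_derivative b $ i) (at \<zeta>))"
proof
  assume *: "(\<phi> has_derivative (\<lambda>h. h *s b)) (at \<zeta>)"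
  show "\<forall>i. ((\<lambda>\<zeta>. \<phi> \<zeta> $ i) has_field_derivative b $ i) (at \<zeta>)"
    using bounded_linear.has_derivative[OF bounded_linear_vec_nth *]
    by (simp add: has_field_derivative_def mult_commute_abs)
next
  assume *: "\<forall>i. ((\<lambda>\<zeta>. \<phi> \<zeta> $ i) has_field_derivative b $ i) (at \<zeta>)"
  show "(\<phi> has_derivative (\<lambda>h. h *s b)) (at \<zeta>)"
    unfolding has_derivative_def
  proof (intro conjI bounded_linear_smult_left vec_tendstoI)
    fix i
    show "((\<lambda>y. ((\<phi> y - \<phi> (Lim (at \<zeta>) (\<lambda>x. x)) - (y - Lim (at \<zeta>) (\<lambda>x. x)) *s b) /\<^sub>R
        norm (y - Lim (at \<zeta>) (\<lambda>x. x))) $ i) \<longlongrightarrow> 0 $ i) (at \<zeta>)"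
      using *[rule_format, of i]
      by (simp add: has_field_derivative_def has_derivative_def algebra_simps)
  qed
qed

text \<open>Complex linearity gives \<open>L (h *s b) = h * L b\<close>, so the real chain rule
  produces a complex derivative.\<close>

lemma holo_fun_on_comp_curve:
  assumes "holo_fun_on f S" "\<phi> \<zeta> \<in> S" "(\<phi> has_derivative (\<lambda>h. h *s b)) (at \<zeta>)"
  shows "(\<lambda>\<zeta>. f (\<phi> \<zeta>)) field_differentiable at \<zeta>"
proof -
  obtain L where L: "(f has_derivative L) (at (\<phi> \<zeta>))" "\<And>c w. L (c *s w) = c * L w"
    using assms by (auto simp: holo_fun_on_def)
  have "((\<lambda>\<zeta>. f (\<phi> \<zeta>)) has_derivative (\<lambda>h. L (h *s b))) (at \<zeta>)"
    using has_derivative_compose[OF assms(3) L(1)] by simp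
  then show ?thesis
    unfolding field_differentiable_def has_field_derivative_def
    by (intro exI[of _ "L b"]) (simp add: L(2) mult_commute_abs)
qed

lemma holo_fun_on_imp_continuous_on: "holo_fun_on f S \<Longrightarrow> continuous_on S f"
  by (metis holo_fun_on_def continuous_at_imp_continuous_on has_derivative_continuous)

lemma has_derivative_affine_curve:
  "((\<lambda>\<zeta>. a + \<zeta> *s (b :: complex ^ 'n)) has_derivative (\<lambda>h. h *s b)) (at \<zeta> within S)"
  using has_derivative_add[OF has_derivative_const bounded_linear_imp_has_derivative[OF bounded_linear_smult_left[of b]]]
  by simp

lemma continuous_on_affine_curve: "continuous_on S (\<lambda>\<zeta>. a + \<zeta> *s (b :: complex ^ 'n))"
  using has_derivative_affine_curve continuous_on_eq_continuous_within has_derivative_continuous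
  by blast

lemma continuous_on_vec_componentwise:
  fixes f :: "'a::topological_space \<Rightarrow> 'b::topological_space ^ 'n"
  assumes "\<And>i. continuous_on S (\<lambda>x. f x $ i)"
  shows "continuous_on S f"
  using assms by (simp add: continuous_on_def vec_tendstoI)

lemma holo_map_on_imp_continuous_on: "holo_map_on F S \<Longrightarrow> continuous_on S F"
  by (simp add: continuous_on_vec_componentwise holo_fun_on_imp_continuous_on holo_map_on_def)

text \<open>Cauchy's inequality on circles of radius \<open>r\<close> about the points of the
  segment bounds the derivative by \<open>M / r\<close>. Large \<open>r\<close> gives Liouville-type
  statements; \<open>r\<close> equal to the reciprocal of a distance gives Lipschitz bounds.\<close>

lemma holomorphic_unit_step_bound:
  assumes hol: "g holomorphic_on S" and r: "r > 0"
    and sub: "\<And>z. z \<in> closed_segment 0 1 \<Longrightarrow> cball z r \<subseteq> S"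
    and bd: "\<And>z. z \<in> S \<Longrightarrow> cmod (g z) \<le> M"
  shows "cmod (g 1 - g 0) \<le> M / r"
proof -
  have d: "(g has_field_derivative deriv g z) (at z within closed_segment 0 1) \<and> cmod (deriv g z) \<le> M / r"
    if z: "z \<in> closed_segment 0 1" for z
  proof
    have hol': "g holomorphic_on cball z r" using hol sub[OF z] holomorphic_on_subset by blast
    then have "g holomorphic_on ball z r" by (rule holomorphic_on_subset) auto
    then show "(g has_field_derivative deriv g z) (at z within closed_segment 0 1)"
      using r by (meson centre_in_ball has_field_derivative_at_within holomorphic_derivI open_ball)
    have "norm ((deriv ^^ 1) g z) \<le> fact 1 * M / r ^ 1"
      using \<open>g holomorphic_on ball z r\<close> hol' r
    proof (intro Cauchy_inequality holomorphic_on_imp_continuous_on)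
      fix x assume "cmod (z - x) = r"
      then show "cmod (g x) \<le> M" using sub[OF z] by (intro bd) (auto simp: dist_norm subset_iff)
    qed auto
    then show "cmod (deriv g z) \<le> M / r" by simp
  qed
  have "cmod (g 1 - g 0) \<le> M / r * cmod (1 - 0)"
    by (rule field_differentiable_bound[where S = "closed_segment 0 1" and f' = "deriv g"]) (use d in auto)
  then show ?thesis by simp
qed

text \<open>\<open>holo_fun_on\<close> provides a derivative at each point but no bound on it, so
  the constant comes from Cauchy's inequality on the complex line through \<open>x\<close> and
  \<open>y\<close>. The room between the radii \<open>B\<close> and \<open>B + 1\<close>
  accommodates discs of radius \<open>1 / norm d\<close> in the line parameter.\<close>

lemma holo_map_Lipschitz_on_cball:
  fixes V :: "complex ^ 'n \<Rightarrow> complex ^ 'm"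
  assumes V: "holo_map_on V UNIV"
  obtains L where "L \<ge> 0"
    "\<And>x y. norm x \<le> B \<Longrightarrow> norm y \<le> B \<Longrightarrow> norm (V x - V y) \<le> L * norm (x - y)"
proof -
  have "bounded (V ` cball 0 (B + 1))"
    by (intro compact_imp_bounded compact_continuous_image compact_cball)
       (meson V continuous_on_subset holo_map_on_imp_continuous_on subset_UNIV)
  then obtain M where M: "M > 0" "\<And>x. norm x \<le> B + 1 \<Longrightarrow> norm (V x) \<le> M"
    by (auto simp: bounded_pos)
  have "norm (V x - V y) \<le> real CARD('m) * M * norm (x - y)" if x: "norm x \<le> B" and y: "norm y \<le> B" for x y
  proof (cases "x = y")
    case False
    define d where "d = x - y"
    have d: "norm d > 0" using False by (simp add: d_def)
    have comp: "cmod (V x $ i - V y $ i) \<le> M * norm d" for i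
    proof -
      define g where "g \<zeta> = V (y + \<zeta> *s d) $ i" for \<zeta>
      define S where "S = {\<zeta>. norm (y + \<zeta> *s d) \<le> B + 1}"
      have "g field_differentiable at \<zeta>" for \<zeta>
        unfolding g_def
        by (rule holo_fun_on_comp_curve[where S = UNIV and f = "\<lambda>z. V z $ i"])
           (use V has_derivative_affine_curve in \<open>auto simp: holo_map_on_def\<close>)
      then have "g holomorphic_on S"
        by (simp add: field_differentiable_at_within holomorphic_on_def)
      then have "cmod (g 1 - g 0) \<le> M / (1 / norm d)"
      proof (rule holomorphic_unit_step_bound)
        show "1 / norm d > 0" using d by simp
        show "cmod (g z) \<le> M" if "z \<in> S" for z
          using that M(2)[of "y + z *s d"] Finite_Cartesian_Product.norm_nth_le[of "V (y + z *s d)" i] by (simp add: g_def S_def)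
        fix z :: complex assume "z \<in> closed_segment 0 1"
        then obtain u where u: "0 \<le> u" "u \<le> 1" "z = of_real u"
          by (auto simp: closed_segment_def scaleR_conv_of_real)
        have "y + z *s d = (1 - u) *\<^sub>R y + u *\<^sub>R x"
          by (simp add: u d_def vec_eq_iff scaleR_conv_of_real[where 'a=complex] algebra_simps)
        then have "norm (y + z *s d) \<le> (1 - u) * norm y + u * norm x"
          using norm_triangle_ineq[of "(1 - u) *\<^sub>R y" "u *\<^sub>R x"] u by simp
        also have "\<dots> \<le> (1 - u) * B + u * B" using x y u by (intro add_mono mult_left_mono) auto
        finally have 1: "norm (y + z *s d) \<le> B" by (simp add: algebra_simps)
        show "cball z (1 / norm d) \<subseteq> S"
        proof
          fix \<zeta> assume "\<zeta> \<in> cball z (1 / norm d)"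
          then have "cmod (\<zeta> - z) \<le> 1 / norm d" by (simp add: dist_norm norm_minus_commute)
          then have "norm ((\<zeta> - z) *s d) \<le> 1"
            using d unfolding norm_vector_smult by (simp add: field_simps)
          moreover have "y + \<zeta> *s d = (y + z *s d) + (\<zeta> - z) *s d"
            by (simp add: vec_eq_iff algebra_simps)
          ultimately show "\<zeta> \<in> S" using 1 norm_triangle_ineq[of "y + z *s d" "(\<zeta> - z) *s d"]
            by (simp add: S_def)
        qed
      qed
      then show ?thesis by (simp add: g_def d_def)
    qed
    have "norm (V x - V y) \<le> (\<Sum>i\<in>UNIV. cmod ((V x - V y) $ i))" by (rule norm_vec_le_sum)
    also have "\<dots> \<le> (\<Sum>i::'m\<in>UNIV. M * norm d)" by (rule sum_mono) (simp add: comp)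
    finally show ?thesis by (simp add: d_def)
  qed simp
  then show ?thesis using M(1) by (intro that[of "real CARD('m) * M"]) auto
qed

text \<open>\<open>W\<close> is Lipschitz only on the ball of radius \<open>B + 1\<close>, so
  Gronwall's estimate is available only while \<open>y\<close> is within distance 1 of
  \<open>x\<close>. The estimate itself keeps the distance below 1, hence the tube is never
  left.\<close>

lemma gronwall_tube:
  fixes x y :: "real \<Rightarrow> 'a::real_inner"
  assumes x: "\<And>t. (x has_vector_derivative W (x t)) (at t)"
    and y: "\<And>t. (y has_vector_derivative W (y t)) (at t)"
    and L: "L \<ge> 0"
    and Lip: "\<And>u v. norm u \<le> B + 1 \<Longrightarrow> norm v \<le> B + 1 \<Longrightarrow> norm (W u - W v) \<le> L * norm (u - v)"
    and xB: "\<And>t. 0 \<le> t \<Longrightarrow> t \<le> 1 \<Longrightarrow> norm (x t) \<le> B"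
    and small: "norm (y 0 - x 0) * exp L < 1"
    and t: "0 \<le> t" "t \<le> 1"
  shows "norm (y t - x t) \<le> norm (y 0 - x 0) * exp L"
proof -
  define d where "d t = y t - x t" for t
  have dd: "(d has_vector_derivative (W (y t) - W (x t))) (at t)" for t
    unfolding d_def using x y by (intro derivative_intros)
  have contd: "continuous_on S d" for S
    using dd by (meson continuous_at_imp_continuous_on has_vector_derivative_continuous)
  have main: "norm (d s) \<le> norm (d 0) * exp L"
    if s: "0 \<le> s" "s \<le> 1" and tube: "\<And>t. 0 \<le> t \<Longrightarrow> t \<le> s \<Longrightarrow> norm (d t) \<le> 1" for s
  proof -
    \<comment> \<open>Integrating factor: inside the tube the derivative of
      \<open>d t \<bullet> d t\<close> is at most \<open>2 * L\<close> times that quantity.\<close>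
    define h where "h t = (d t \<bullet> d t) * exp (- 2 * L * t)" for t
    have "h s \<le> h 0"
    proof (rule DERIV_nonpos_imp_nonincreasing[OF s(1)])
      fix t assume t: "0 \<le> t" "t \<le> s"
      have "((\<lambda>t. d t \<bullet> d t) has_real_derivative 2 * (d t \<bullet> (W (y t) - W (x t)))) (at t)"
        using has_derivative_inner[OF dd[unfolded has_vector_derivative_def] dd[unfolded has_vector_derivative_def], of t]
        unfolding has_field_derivative_def
        by (rule has_derivative_eq_rhs) (auto simp: fun_eq_iff inner_commute algebra_simps)
      moreover have "((\<lambda>t. exp (- 2 * L * t)) has_real_derivative - 2 * L * exp (- 2 * L * t)) (at t)"
        by (auto intro!: derivative_eq_intros)
      ultimately have "(h has_real_derivative
          (2 * (d t \<bullet> (W (y t) - W (x t))) - 2 * L * (d t \<bullet> d t)) * exp (- 2 * L * t)) (at t)"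
        unfolding h_def by (auto dest: DERIV_mult simp: algebra_simps elim: DERIV_cong)
      moreover have "d t \<bullet> (W (y t) - W (x t)) \<le> L * (d t \<bullet> d t)"
      proof -
        have nx: "norm (x t) \<le> B" using xB t s by simp
        have "norm (y t) \<le> norm (x t) + norm (d t)" using norm_triangle_ineq[of "x t" "d t"] by (simp add: d_def)
        then have "norm (W (y t) - W (x t)) \<le> L * norm (d t)"
          using nx tube[OF t] unfolding d_def by (intro Lip) auto
        then have "norm (d t) * norm (W (y t) - W (x t)) \<le> norm (d t) * (L * norm (d t))"
          by (intro mult_left_mono) auto
        then show ?thesis using norm_cauchy_schwarz[of "d t" "W (y t) - W (x t)"]
          by (simp add: dot_square_norm power2_eq_square mult_ac)
      qed
      ultimately show "\<exists>z. (h has_real_derivative z) (at t) \<and> z \<le> 0"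
        by (intro exI conjI) (assumption, simp add: mult_le_0_iff)
    qed
    then have "(norm (d s))\<^sup>2 * exp (- 2 * L * s) \<le> (norm (d 0))\<^sup>2"
      by (simp add: h_def dot_square_norm)
    then have "(norm (d s))\<^sup>2 \<le> (norm (d 0))\<^sup>2 * exp (2 * L * s)"
      by (simp add: exp_minus field_simps)
    also have "\<dots> \<le> (norm (d 0))\<^sup>2 * exp (2 * L)"
      using L s by (intro mult_left_mono) (auto intro: mult_left_le)
    also have "\<dots> = (norm (d 0) * exp L)\<^sup>2" by (simp add: power_mult_distrib exp_double)
    finally show ?thesis by (rule power2_le_imp_le) simp
  qed
  have "norm (d 0) \<le> norm (d 0) * exp L" using L by (simp add: mult_le_cancel_left1)
  then have d0: "norm (d 0) < 1" using small by (simp add: d_def)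
  have "norm (d s) < 1" if s: "0 \<le> s" "s \<le> 1" for s
  proof (rule ccontr)
    assume "\<not> norm (d s) < 1"
    \<comment> \<open>At the first time \<open>m\<close> in \<open>T\<close> the distance is exactly
      1 by continuity, whereas \<open>main\<close> on the interval up to \<open>m\<close> makes it
      less than 1.\<close>
    define T where "T = {t \<in> {0..1}. norm (d t) \<ge> 1}"
    have "T = {0..1} \<inter> {t. 1 \<le> norm (d t)}" by (auto simp: T_def)
    moreover have "closed {t. 1 \<le> norm (d t)}"
      by (intro closed_Collect_le continuous_intros contd)
    ultimately have "compact T" by (simp add: compact_Int_closed)
    moreover have "s \<in> T" using s \<open>\<not> norm (d s) < 1\<close> by (simp add: T_def)
    ultimately obtain m where m: "m \<in> T" "\<And>t. t \<in> T \<Longrightarrow> m \<le> t"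
      using compact_attains_inf[of T] by blast
    have m1: "0 \<le> m" "m \<le> 1" "1 \<le> norm (d m)" using m(1) by (auto simp: T_def)
    have "\<exists>t\<ge>0. t \<le> m \<and> norm (d t) = 1"
      by (rule IVT') (use m1 d0 in \<open>auto intro!: continuous_intros contd\<close>)
    then have "norm (d m) = 1" using m(2) m1 by (force simp: T_def)
    moreover have "norm (d m) \<le> norm (d 0) * exp L"
    proof (rule main[OF m1(1,2)])
      fix t assume "0 \<le> t" "t \<le> m"
      then show "norm (d t) \<le> 1"
        using m(2)[of t] m1 \<open>norm (d m) = 1\<close> by (cases "t = m") (auto simp: T_def intro: leI dest: less_imp_le)
    qed
    ultimately show False using small by (simp add: d_def)
  qed
  then show ?thesis using main[OF t] t unfolding d_def by force
qed

text \<open>Along a ray of direction \<open>c\<close>, complex time becomes a real-time equation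
  with field \<open>c *s V\<close>. One constant serves all directions with
  \<open>cmod c \<le> R\<close>, which makes later estimates uniform on a disc of times.\<close>

lemma holo_map_uniform_dependence:
  fixes V :: "complex ^ 'n \<Rightarrow> complex ^ 'n"
  assumes V: "holo_map_on V UNIV"
  obtains C where "C > 0" "\<And>c x y t.
    \<lbrakk>cmod c \<le> R; \<And>t. (x has_vector_derivative c *s V (x t)) (at t);
     \<And>t. (y has_vector_derivative c *s V (y t)) (at t);
     \<And>t. 0 \<le> t \<Longrightarrow> t \<le> 1 \<Longrightarrow> norm (x t) \<le> B;
     norm (y 0 - x 0) * C < 1; 0 \<le> t; t \<le> (1::real)\<rbrakk> \<Longrightarrow> norm (y t - x t) \<le> norm (y 0 - x 0) * C"
proof -
  obtain L where L: "L \<ge> 0" "\<And>x y. norm x \<le> B + 1 \<Longrightarrow> norm y \<le> B + 1 \<Longrightarrow> norm (V x - V y) \<le> L * norm (x - y)"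
    using holo_map_Lipschitz_on_cball[OF V, of "B + 1"] by blast
  show ?thesis
  proof (rule that[of "exp (\<bar>R\<bar> * L)"])
    fix c x y and t :: real
    assume c: "cmod c \<le> R" and x: "\<And>t. (x has_vector_derivative c *s V (x t)) (at t)"
      and y: "\<And>t. (y has_vector_derivative c *s V (y t)) (at t)"
      and B: "\<And>t. 0 \<le> t \<Longrightarrow> t \<le> 1 \<Longrightarrow> norm (x t) \<le> B"
      and small: "norm (y 0 - x 0) * exp (\<bar>R\<bar> * L) < 1" and t: "0 \<le> t" "t \<le> 1"
    show "norm (y t - x t) \<le> norm (y 0 - x 0) * exp (\<bar>R\<bar> * L)"
    proof (rule gronwall_tube[where W = "\<lambda>u. c *s V u" and B = B, OF x y _ _ B small t])
      fix u v :: "complex ^ 'n" assume "norm u \<le> B + 1" "norm v \<le> B + 1"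
      then have "norm (V u - V v) \<le> L * norm (u - v)" by (rule L)
      then have "cmod c * norm (V u - V v) \<le> \<bar>R\<bar> * (L * norm (u - v))" using c by (intro mult_mono) auto
      then show "norm (c *s V u - c *s V v) \<le> \<bar>R\<bar> * L * norm (u - v)"
        by (simp add: norm_vector_smult mult_ac flip: vector_ssub_ldistrib)
    qed (use L in auto)
  qed auto
qed

section \<open>The complex-time flow: rays, uniqueness, group law, dependence on the initial
  point\<close>

lemma flow_ray_has_vector_derivative:
  assumes "is_complex_flow V X"
  shows "((\<lambda>t. X (of_real t * c + \<mu>) z) has_vector_derivative c *s V (X (of_real t * c + \<mu>) z)) (at t)"
proof -
  have 1: "((\<lambda>t::real. of_real t * c + \<mu>) has_derivative (\<lambda>h. of_real h * c)) (at t)"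
    by (auto intro!: derivative_eq_intros)
  have 2: "((\<lambda>\<mu>. X \<mu> z) has_derivative (\<lambda>h. h *s V (X (of_real t * c + \<mu>) z))) (at (of_real t * c + \<mu>))"
    using assms by (auto simp: is_complex_flow_def)
  have 3: "(\<lambda>h. (of_real h * c) *s V (X (of_real t * c + \<mu>) z)) =
    (\<lambda>h. h *\<^sub>R (c *s V (X (of_real t * c + \<mu>) z)))"
    by (auto simp: fun_eq_iff vec_eq_iff scaleR_conv_of_real[where 'a=complex])
  show ?thesis using has_derivative_compose[OF 1 2] unfolding has_vector_derivative_def 3 .
qed

lemma flow_continuous_on: "is_complex_flow V X \<Longrightarrow> continuous_on S (\<lambda>\<mu>. X \<mu> z)"
  unfolding is_complex_flow_def
  by (meson continuous_at_imp_continuous_on has_derivative_continuous)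

lemma holo_ode_unique:
  fixes V :: "complex ^ 'n \<Rightarrow> complex ^ 'n"
  assumes V: "holo_map_on V UNIV"
    and x: "\<And>t. (x has_vector_derivative c *s V (x t)) (at t)"
    and y: "\<And>t. (y has_vector_derivative c *s V (y t)) (at t)"
    and eq: "x 0 = y 0"
  shows "x (1::real) = y 1"
proof -
  have "continuous_on {0..1} x"
    using x by (meson continuous_at_imp_continuous_on has_vector_derivative_continuous)
  then have "bounded (x ` {0..1})" by (intro compact_imp_bounded compact_continuous_image) auto
  then obtain B where B: "\<And>t. 0 \<le> t \<Longrightarrow> t \<le> 1 \<Longrightarrow> norm (x t) \<le> B"
    unfolding bounded_iff by fastforce
  obtain C where C: "C > 0" "\<And>c' x y t.
    \<lbrakk>cmod c' \<le> cmod c; \<And>t. (x has_vector_derivative c' *s V (x t)) (at t);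
     \<And>t. (y has_vector_derivative c' *s V (y t)) (at t);
     \<And>t. 0 \<le> t \<Longrightarrow> t \<le> 1 \<Longrightarrow> norm (x t) \<le> B;
     norm (y 0 - x 0) * C < 1; 0 \<le> t; t \<le> (1::real)\<rbrakk> \<Longrightarrow> norm (y t - x t) \<le> norm (y 0 - x 0) * C"
    using holo_map_uniform_dependence[OF V] by blast
  have "norm (y 1 - x 1) \<le> norm (y 0 - x 0) * C"
    by (rule C(2)[of c]) (use x y B eq in auto)
  then show ?thesis by (simp add: eq)
qed

text \<open>Both sides are time-one values of solutions along a ray of direction
  \<open>\<sigma>\<close> that start at \<open>X \<mu> z\<close>, so uniqueness of solutions
  identifies them.\<close>

lemma flow_add:
  assumes V: "holo_map_on V UNIV" and X: "is_complex_flow V X"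
  shows "X (\<sigma> + \<mu>) z = X \<sigma> (X \<mu> z)"
proof -
  have "X (of_real 1 * \<sigma> + \<mu>) z = X (of_real 1 * \<sigma> + 0) (X \<mu> z)"
    using X
    by (intro holo_ode_unique[OF V, where c = \<sigma> and x = "\<lambda>t. X (of_real t * \<sigma> + \<mu>) z"
          and y = "\<lambda>t. X (of_real t * \<sigma> + 0) (X \<mu> z)"] flow_ray_has_vector_derivative[OF X])
       (auto simp: is_complex_flow_def)
  then show ?thesis by simp
qed

text \<open>The orbit of \<open>w\<close> over the compact disc of times is bounded, so one ball
  serves all rays. Uniformity in \<open>\<sigma>\<close> keeps the whole flow disc of a nearby point
  close to that of \<open>w\<close>.\<close>

lemma flow_locally_Lipschitz:
  fixes V :: "complex ^ 'n \<Rightarrow> complex ^ 'n"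
  assumes V: "holo_map_on V UNIV" and X: "is_complex_flow V X"
  obtains C where "C > 0" "\<And>\<sigma> z. cmod \<sigma> \<le> R \<Longrightarrow> norm (z - w) * C < 1 \<Longrightarrow>
    norm (X \<sigma> z - X \<sigma> w) \<le> norm (z - w) * C"
proof -
  have "bounded ((\<lambda>\<sigma>. X \<sigma> w) ` cball 0 R)"
    by (intro compact_imp_bounded compact_continuous_image flow_continuous_on[OF X] compact_cball)
  then obtain B where B: "\<And>\<sigma>. cmod \<sigma> \<le> R \<Longrightarrow> norm (X \<sigma> w) \<le> B"
    unfolding bounded_iff by fastforce
  obtain C where C: "C > 0" "\<And>c x y t.
    \<lbrakk>cmod c \<le> R; \<And>t. (x has_vector_derivative c *s V (x t)) (at t);
     \<And>t. (y has_vector_derivative c *s V (y t)) (at t);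
     \<And>t. 0 \<le> t \<Longrightarrow> t \<le> 1 \<Longrightarrow> norm (x t) \<le> B;
     norm (y 0 - x 0) * C < 1; 0 \<le> t; t \<le> (1::real)\<rbrakk> \<Longrightarrow> norm (y t - x t) \<le> norm (y 0 - x 0) * C"
    using holo_map_uniform_dependence[OF V] by blast
  show ?thesis
  proof (rule that[OF C(1)])
    fix \<sigma> z assume \<sigma>: "cmod \<sigma> \<le> R" and z: "norm (z - w) * C < 1"
    have X0: "X 0 u = u" for u using X by (simp add: is_complex_flow_def)
    have "norm (X (of_real 1 * \<sigma> + 0) z - X (of_real 1 * \<sigma> + 0) w)
      \<le> norm (X (of_real 0 * \<sigma> + 0) z - X (of_real 0 * \<sigma> + 0) w) * C"
    proof (rule C(2)[OF \<sigma> flow_ray_has_vector_derivative[OF X] flow_ray_has_vector_derivative[OF X]])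
      fix t :: real assume "0 \<le> t" "t \<le> 1"
      then have "cmod (of_real t * \<sigma> + 0) \<le> cmod \<sigma>"
        by (simp add: norm_mult mult_left_le_one_le)
      then show "norm (X (of_real t * \<sigma> + 0) w) \<le> B" using \<sigma> by (intro B) simp
    qed (use z X0 in auto)
    then show "norm (X \<sigma> z - X \<sigma> w) \<le> norm (z - w) * C" by (simp add: X0)
  qed
qed

section \<open>A maximum principle for plurisubharmonic functions on holomorphic curves\<close>

lemma holomorphic_circle_mean:
  fixes f :: "complex \<Rightarrow> complex"
  assumes f: "f holomorphic_on cball a r" and r: "r > 0"
  shows "((\<lambda>\<theta>. f (a + of_real r * cis \<theta>)) has_integral 2 * pi * f a) {0..2*pi}"
proof -
  have "((\<lambda>u. f u / (u - a)) has_contour_integral (2 * of_real pi * \<i> * f a)) (part_circlepath a r 0 (2*pi))"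
    using Cauchy_integral_circlepath_simple[OF f, of a] r by (simp add: circlepath_def)
  then have "((\<lambda>\<theta>. f (a + of_real r * cis \<theta>) / (a + of_real r * cis \<theta> - a) * of_real r * \<i> * cis \<theta>)
      has_integral (2 * of_real pi * \<i> * f a)) {0..2*pi}"
    by (subst (asm) has_contour_integral_part_circlepath_iff) auto
  then have "((\<lambda>\<theta>. \<i> * f (a + of_real r * cis \<theta>)) has_integral (2 * of_real pi * \<i> * f a)) {0..2*pi}"
    by (rule has_integral_eq[rotated]) (use r in \<open>simp add: field_simps\<close>)
  from has_integral_mult_right[OF this, of "- \<i>"] show ?thesis
    by (simp add: algebra_simps)
qed

lemma circle_point_in_cball: "r > 0 \<Longrightarrow> a + of_real r * cis \<theta> \<in> cball a r"
  by (simp add: dist_norm norm_mult)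

lemma continuous_on_circle: "continuous_on S (\<lambda>\<theta>. a + of_real r * cis \<theta>)"
  by (intro continuous_intros)

text \<open>Pythagoras on a circle: \<open>f - f a\<close> has mean zero, so the cross term with the
  constant \<open>f a\<close> vanishes. The exact identity later allows terms of second order in the
  radius to be compared.\<close>

lemma holomorphic_circle_mean_norm_sq:
  assumes f: "f holomorphic_on cball a r" and r: "r > 0"
  shows "integral {0..2*pi} (\<lambda>\<theta>. (cmod (f (a + of_real r * cis \<theta>)))\<^sup>2) =
    2 * pi * (cmod (f a))\<^sup>2 + integral {0..2*pi} (\<lambda>\<theta>. (cmod (f (a + of_real r * cis \<theta>) - f a))\<^sup>2)"
proof -
  let ?z = "\<lambda>\<theta>. a + of_real r * cis \<theta>"
  have cont: "continuous_on {0..2*pi} (\<lambda>\<theta>. f (?z \<theta>))"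
    by (rule continuous_on_compose2[OF holomorphic_on_imp_continuous_on[OF f] continuous_on_circle])
       (use circle_point_in_cball[OF r] in blast)
  have "((\<lambda>\<theta>. cnj (f a) * (f (?z \<theta>) - f a)) has_integral 2 * pi * (cnj (f a) * (f a - f a))) {0..2*pi}"
    by (rule holomorphic_circle_mean[where f = "\<lambda>z. cnj (f a) * (f z - f a)"])
       (use f r in \<open>auto intro!: holomorphic_on_mult holomorphic_on_diff holomorphic_on_const\<close>)
  then have 1: "((\<lambda>\<theta>. Re (cnj (f a) * (f (?z \<theta>) - f a))) has_integral 0) {0..2*pi}"
    by (auto dest: has_integral_Re)
  have 2: "((\<lambda>\<theta>. (cmod (f (?z \<theta>) - f a))\<^sup>2) has_integral
      integral {0..2*pi} (\<lambda>\<theta>. (cmod (f (?z \<theta>) - f a))\<^sup>2)) {0..2*pi}"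
    by (intro integrable_integral integrable_continuous_real continuous_intros cont)
  have 3: "((\<lambda>\<theta>. (cmod (f a))\<^sup>2) has_integral (2 * pi * (cmod (f a))\<^sup>2)) {0..2*pi}"
    using has_integral_const_real[of "(cmod (f a))\<^sup>2" 0 "2*pi"] by simp
  have "(cmod c)\<^sup>2 + (2 * Re (cnj c * (w - c)) + (cmod (w - c))\<^sup>2) = (cmod w)\<^sup>2" for c w
    unfolding cmod_power2 by (simp add: power2_eq_square algebra_simps)
  then have "(\<lambda>\<theta>. (cmod (f a))\<^sup>2 + (2 * Re (cnj (f a) * (f (?z \<theta>) - f a)) + (cmod (f (?z \<theta>) - f a))\<^sup>2)) =
    (\<lambda>\<theta>. (cmod (f (?z \<theta>)))\<^sup>2)"
    by simp
  then show ?thesis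
    using has_integral_add[OF 3 has_integral_add[OF has_integral_mult_right[OF 1, of 2] 2]]
    by (simp add: integral_unique)
qed

lemma norm_vec_sq: "(norm (v :: complex ^ 'n))\<^sup>2 = (\<Sum>i\<in>UNIV. (cmod (v $ i))\<^sup>2)"
  by (simp add: norm_vec_def L2_set_def sum_nonneg)

lemma holomorphic_curve_circle_mean_norm_sq:
  fixes F :: "complex \<Rightarrow> complex ^ 'n"
  assumes F: "\<And>i. (\<lambda>z. F z $ i) holomorphic_on cball a r" and r: "r > 0"
  shows "integral {0..2*pi} (\<lambda>\<theta>. (norm (F (a + of_real r * cis \<theta>)))\<^sup>2) =
    2 * pi * (norm (F a))\<^sup>2 + integral {0..2*pi} (\<lambda>\<theta>. (norm (F (a + of_real r * cis \<theta>) - F a))\<^sup>2)"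
proof -
  have cont: "continuous_on {0..2*pi} (\<lambda>\<theta>. F (a + of_real r * cis \<theta>) $ i)" for i
    by (rule continuous_on_compose2[OF holomorphic_on_imp_continuous_on[OF F] continuous_on_circle])
       (use circle_point_in_cball[OF r] in blast)
  have "integral {0..2*pi} (\<lambda>\<theta>. (norm (F (a + of_real r * cis \<theta>)))\<^sup>2) =
    (\<Sum>i\<in>UNIV. integral {0..2*pi} (\<lambda>\<theta>. (norm (F (a + of_real r * cis \<theta>) $ i))\<^sup>2))"
    unfolding norm_vec_sq
    by (intro integral_sum integrable_continuous_real continuous_intros cont) auto
  also have "\<dots> = 2 * pi * (norm (F a))\<^sup>2 +
      (\<Sum>i\<in>UNIV. integral {0..2*pi} (\<lambda>\<theta>. (norm (F (a + of_real r * cis \<theta>) $ i - F a $ i))\<^sup>2))"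
    by (simp add: holomorphic_circle_mean_norm_sq[OF F r] sum.distrib norm_vec_sq sum_distrib_left)
  also have "(\<Sum>i\<in>UNIV. integral {0..2*pi} (\<lambda>\<theta>. (norm (F (a + of_real r * cis \<theta>) $ i - F a $ i))\<^sup>2)) =
     integral {0..2*pi} (\<lambda>\<theta>. (norm (F (a + of_real r * cis \<theta>) - F a))\<^sup>2)"
    unfolding norm_vec_sq vector_minus_component
    by (intro integral_sum[symmetric] integrable_continuous_real continuous_intros cont) auto
  finally show ?thesis .
qed

text \<open>Stands in for harmonicity: exact circle means for all small radii at one point are what
  the comparison with a subharmonic function consumes.\<close>

definition mean_value_at :: "(complex \<Rightarrow> real) \<Rightarrow> complex \<Rightarrow> bool" where
  "mean_value_at H a \<longleftrightarrow> (\<exists>R>0. \<forall>r. 0 < r \<and> r < R \<longrightarrow>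
     ((\<lambda>\<theta>. H (a + of_real r * cis \<theta>)) has_integral 2 * pi * H a) {0..2*pi})"

lemma mean_value_at_Re_holomorphic:
  assumes f: "f holomorphic_on ball a R" and R: "R > 0"
    and H: "\<And>z. z \<in> ball a R \<Longrightarrow> H z = Re (f z)"
  shows "mean_value_at H a"
  unfolding mean_value_at_def
proof (intro exI[of _ R] conjI allI impI R)
  fix r assume r: "0 < r \<and> r < R"
  then have sub: "cball a r \<subseteq> ball a R" by auto
  have "((\<lambda>\<theta>. Re (f (a + of_real r * cis \<theta>))) has_integral Re (2 * pi * f a)) {0..2*pi}"
    by (rule has_integral_Re[OF holomorphic_circle_mean])
       (use r holomorphic_on_subset[OF f sub] in auto)
  moreover have "Re (f (a + of_real r * cis \<theta>)) = H (a + of_real r * cis \<theta>)" for \<theta>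
    using circle_point_in_cball[of r a \<theta>] r sub by (intro H[symmetric]) blast
  ultimately show "((\<lambda>\<theta>. H (a + of_real r * cis \<theta>)) has_integral 2 * pi * H a) {0..2*pi}"
    using H[of a] R by simp
qed

text \<open>Subharmonicity of the composition of \<open>u\<close> with a holomorphic disc is available only for affine
  discs. A penalised maximum of \<open>u (\<phi> \<zeta> + y)\<close> over \<open>(\<zeta>, y)\<close> is therefore tested along the
  tangent line to \<open>\<phi>\<close>: moving along this line changes \<open>y\<close> only by \<open>o(\<tau>)\<close>, which cannot
  compensate the strictly subharmonic perturbation \<open>\<delta> * (cmod \<zeta>)\<^sup>2\<close>.\<close>

lemma psh_maximum_principle:
  fixes u :: "complex ^ 'n \<Rightarrow> real"
  assumes U: "open U" and psh: "psh_on U u" and K: "compact K" and sub: "\<phi> ` K \<subseteq> U"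
    and der: "\<And>\<zeta>. \<zeta> \<in> K \<Longrightarrow> (\<phi> has_derivative (\<lambda>h. h *s \<phi>' \<zeta>)) (at \<zeta>)"
    and contH: "continuous_on K H" and mv: "\<And>a. a \<in> interior K \<Longrightarrow> mean_value_at H a"
    and bd: "\<And>\<zeta>. \<zeta> \<in> frontier K \<Longrightarrow> u (\<phi> \<zeta>) \<le> H \<zeta>"
    and \<zeta>0: "\<zeta>0 \<in> K"
  shows "u (\<phi> \<zeta>0) \<le> H \<zeta>0"
proof (rule ccontr)
  define g where "g = u (\<phi> \<zeta>0) - H \<zeta>0"
  assume "\<not> u (\<phi> \<zeta>0) \<le> H \<zeta>0"
  then have g: "g > 0" by (simp add: g_def)
  have contu: "continuous_on U u" using psh by (simp add: psh_on_def)
  have cont\<phi>: "continuous_on K \<phi>"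
    using der by (meson continuous_at_imp_continuous_on has_derivative_continuous)
  obtain B where B: "B > 0" "\<And>\<zeta>. \<zeta> \<in> K \<Longrightarrow> cmod \<zeta> \<le> B"
    using compact_imp_bounded[OF K] by (auto simp: bounded_pos)
  \<comment> \<open>The factor 3 splits the gap \<open>g\<close>: one third pays for this
    perturbation, one third for the shift \<open>y\<close>, and the last keeps the boundary
    inequality strict.\<close>
  define \<delta> where "\<delta> = g / (3 * B\<^sup>2)"
  have \<delta>: "\<delta> > 0" using g B by (simp add: \<delta>_def)
  have \<delta>B: "\<delta> * (cmod \<zeta>)\<^sup>2 \<le> g / 3" if "\<zeta> \<in> K" for \<zeta>
  proof -
    have "\<delta> * (cmod \<zeta>)\<^sup>2 \<le> \<delta> * B\<^sup>2" using \<delta> B(2)[OF that] by (intro mult_left_mono power_mono) auto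
    then show ?thesis using B(1) by (simp add: \<delta>_def)
  qed
  have cK: "compact (\<phi> ` K)" by (rule compact_continuous_image[OF cont\<phi> K])
  obtain e1 where e1: "e1 > 0" "{x + y |x y. x \<in> \<phi> ` K \<and> y \<in> cball 0 e1} \<subseteq> U"
  proof -
    obtain e where e: "e > 0" "{x. infdist x (\<phi> ` K) \<le> e} \<subseteq> U"
      using compact_in_open_separated[OF _ cK U sub] \<zeta>0 by blast
    have "infdist (x + y) (\<phi> ` K) \<le> e" if "x \<in> \<phi> ` K" "y \<in> cball 0 e" for x y
      using infdist_le2[OF that(1), of "x + y" e] that(2) by (simp add: dist_norm)
    with e show ?thesis by (intro that[of e]) auto
  qed
  define T where "T = {x + y |x y. x \<in> \<phi> ` K \<and> y \<in> cball 0 e1}"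
  have T: "compact T" "T \<subseteq> U" using compact_sums[OF cK compact_cball[of 0 e1]] e1(2) by (simp_all only: T_def)
  have "uniformly_continuous_on T u"
    by (intro compact_uniformly_continuous continuous_on_subset[OF contu] T)
  then obtain e2 where e2: "e2 > 0" "\<And>x y. x \<in> T \<Longrightarrow> y \<in> T \<Longrightarrow> dist y x < e2 \<Longrightarrow> dist (u y) (u x) < g / 3"
    using g unfolding uniformly_continuous_on_def by (metis divide_pos_pos zero_less_numeral)
  define \<eta> where "\<eta> = min e1 (e2 / 2)"
  have \<eta>: "\<eta> > 0" "\<eta> \<le> e1" "\<eta> < e2" using e1 e2 by (auto simp: \<eta>_def)
  have inT: "\<phi> \<zeta> + y \<in> T" if "\<zeta> \<in> K" "norm y \<le> \<eta>" for \<zeta> y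
    using that \<eta> unfolding T_def by (intro CollectI exI[of _ "\<phi> \<zeta>"] exI[of _ y]) auto
  have near: "u (\<phi> \<zeta> + y) < u (\<phi> \<zeta>) + g / 3" if "\<zeta> \<in> K" "norm y \<le> \<eta>" for \<zeta> y
  proof -
    have "dist (u (\<phi> \<zeta> + y)) (u (\<phi> \<zeta>)) < g / 3"
      by (rule e2) (use that \<eta> inT[of \<zeta> y] inT[of \<zeta> 0] in \<open>auto simp: dist_norm\<close>)
    then show ?thesis by (auto simp: dist_real_def abs_if split: if_splits)
  qed
  define KK where "KK = K \<times> cball (0 :: complex ^ 'n) \<eta>"
  have KK: "compact KK" unfolding KK_def by (intro compact_Times K compact_cball)
  \<comment> \<open>The vector \<open>snd w\<close> decouples the argument of \<open>u\<close> from
    the curve, and the penalty \<open>k\<close> holds it near zero. Maximising over pairs lets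
    \<open>u\<close> be compared at points off the curve, as a tangent line requires.\<close>
  define G where "G k w = u (\<phi> (fst w) + snd w) + \<delta> * (cmod (fst w))\<^sup>2 - H (fst w) - k * (norm (snd w))\<^sup>2"
    for k :: real and w :: "complex \<times> (complex ^ 'n)"
  have contG: "continuous_on KK (G k)" for k
  proof -
    have 1: "continuous_on KK (\<lambda>w. \<phi> (fst w))"
      by (rule continuous_on_compose2[OF cont\<phi>]) (auto simp: KK_def intro: continuous_intros)
    have 2: "continuous_on KK (\<lambda>w. H (fst w))"
      by (rule continuous_on_compose2[OF contH]) (auto simp: KK_def intro: continuous_intros)
    have 3: "continuous_on KK (\<lambda>w. u (\<phi> (fst w) + snd w))"
    proof (rule continuous_on_compose2[OF contu])
      show "(\<lambda>w. \<phi> (fst w) + snd w) ` KK \<subseteq> U" using inT T by (auto simp: KK_def)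
    qed (intro continuous_intros 1)
    show ?thesis unfolding G_def by (intro continuous_intros 2 3)
  qed
  have "bounded (G 0 ` KK)" by (intro compact_imp_bounded compact_continuous_image contG KK)
  then obtain M where M: "\<And>w. w \<in> KK \<Longrightarrow> G 0 w \<le> M"
    by (metis bounded_imp_bdd_above bdd_above_def imageI)
  \<comment> \<open>\<open>M\<close> bounds the unpenalised function, so this penalty makes
    \<open>G k\<close> negative where the shift has norm \<open>\<eta>\<close>; the maximiser
    therefore has \<open>norm ys < \<eta>\<close>.\<close>
  define k where "k = (\<bar>M\<bar> + 1) / \<eta>\<^sup>2"
  have k: "k > 0" "k * \<eta>\<^sup>2 > M" using \<eta> by (auto simp: k_def)
  have z0KK: "(\<zeta>0, 0) \<in> KK" using \<zeta>0 \<eta> by (simp add: KK_def)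
  obtain ws where ws: "ws \<in> KK" "\<And>w. w \<in> KK \<Longrightarrow> G k w \<le> G k ws"
    using continuous_attains_sup[OF KK _ contG[of k]] z0KK by blast
  define a ys where "a = fst ws" "ys = snd ws"
  have a: "a \<in> K" and ys: "norm ys \<le> \<eta>" using ws(1) by (auto simp: a_ys_def KK_def)
  have Gs: "G k ws \<ge> g"
  proof -
    have "g \<le> G k (\<zeta>0, 0)" using \<delta> by (simp add: G_def g_def)
    also have "\<dots> \<le> G k ws" by (rule ws(2)[OF z0KK])
    finally show ?thesis .
  qed
  \<comment> \<open>Over the frontier \<open>G k\<close> stays below \<open>g / 3 + g / 3\<close>,
    while at \<open>(\<zeta>0, 0)\<close> it is at least \<open>g\<close>.\<close>
  have "a \<notin> frontier K"
  proof
    assume "a \<in> frontier K"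
    then have "u (\<phi> a + ys) + \<delta> * (cmod a)\<^sup>2 - H a < g"
      using bd[of a] near[OF a ys] \<delta>B[OF a] g by linarith
    moreover have "k * (norm ys)\<^sup>2 \<ge> 0" using k by simp
    ultimately show False using Gs by (simp add: G_def a_ys_def)
  qed
  then have ai: "a \<in> interior K"
    using a compact_imp_closed[OF K] by (simp add: frontier_def)
  have ys': "norm ys < \<eta>"
  proof (rule ccontr)
    assume "\<not> norm ys < \<eta>"
    then have "norm ys = \<eta>" using ys by simp
    then have "G k ws = G 0 ws - k * \<eta>\<^sup>2" by (simp add: G_def a_ys_def)
    then show False using M[OF ws(1)] k Gs g by simp
  qed
  define p b where "p = \<phi> a + ys" "b = \<phi>' a"
  \<comment> \<open>Chosen so that \<open>\<phi> z + y z\<close> runs along the tangent line through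
    \<open>p\<close>. It is holomorphic near \<open>a\<close> and differs from \<open>ys\<close>
    only by the linearisation error of \<open>\<phi>\<close>.\<close>
  define y where "y z = p + (z - a) *s b - \<phi> z" for z
  have ya: "y a = ys" by (simp add: y_def p_b_def)
  \<comment> \<open>With \<open>k * e\<^sup>2 = \<delta> / 2\<close> the penalty eats at most half
    of the gain \<open>\<delta> * r\<^sup>2\<close> from the perturbation.\<close>
  define e where "e = sqrt (\<delta> / (2 * k))"
  have e: "e > 0" "k * e\<^sup>2 = \<delta> / 2" using \<delta> k by (auto simp: e_def)
  obtain d1 where d1: "d1 > 0" "\<And>z. cmod (z - a) < d1 \<Longrightarrow> norm (\<phi> z - \<phi> a - (z - a) *s b) \<le> e * cmod (z - a)"
    using der[OF a] e(1) unfolding has_derivative_at_alt p_b_def by blast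
  obtain d2 where d2: "d2 > 0" "cball a d2 \<subseteq> K" using ai by (auto simp: mem_interior_cball)
  obtain d3 where d3: "d3 > 0" "\<And>r. 0 < r \<and> r < d3 \<Longrightarrow>
     ((\<lambda>\<theta>. H (a + of_real r * cis \<theta>)) has_integral 2 * pi * H a) {0..2*pi}"
    using mv[OF ai] unfolding mean_value_at_def by blast
  have pU: "p \<in> U" using inT[OF a ys] T by (auto simp: p_b_def)
  have "subharmonic_on {\<zeta>. p + \<zeta> *s b \<in> U} (\<lambda>\<zeta>. u (p + \<zeta> *s b))"
    using psh by (simp add: psh_on_def)
  moreover have "0 \<in> {\<zeta>. p + \<zeta> *s b \<in> U}" using pU by simp
  ultimately have "\<exists>R>0. \<forall>r. 0 < r \<and> r < R \<longrightarrow>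
      u (p + 0 *s b) \<le> integral {0..2*pi} (\<lambda>\<theta>. u (p + (0 + of_real r * cis \<theta>) *s b)) / (2*pi)"
    unfolding subharmonic_on_def by blast
  then obtain d4 where d4: "d4 > 0" "\<And>r. 0 < r \<and> r < d4 \<Longrightarrow>
      u p \<le> integral {0..2*pi} (\<lambda>\<theta>. u (p + (of_real r * cis \<theta>) *s b)) / (2*pi)"
    by auto
  define r where "r = min (min (d1 / 2) d2) (min (min (d3 / 2) (d4 / 2)) ((\<eta> - norm ys) / e))"
  have r: "r > 0" "r < d1" "r \<le> d2" "r < d3" "r < d4" "r \<le> (\<eta> - norm ys) / e"
    using d1 d2 d3 d4 e ys' by (auto simp: r_def min_less_iff_disj)
  have re: "e * r \<le> \<eta> - norm ys" using r(6) e by (simp add: field_simps)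
  have zK: "z \<in> K" if "z \<in> cball a r" for z using that r d2 by (auto simp: subset_iff)
  have hy: "norm (y z - y a) \<le> e * r" if "z \<in> cball a r" for z
  proof -
    have "y z - y a = - (\<phi> z - \<phi> a - (z - a) *s b)" by (simp add: y_def)
    then have "norm (y z - y a) \<le> e * cmod (z - a)"
      using d1(2)[of z] that r by (metis dist_commute dist_norm le_less_trans mem_cball norm_minus_cancel)
    also have "\<dots> \<le> e * r" using that e by (simp add: dist_norm norm_minus_commute)
    finally show ?thesis .
  qed
  have yz: "norm (y z) \<le> \<eta>" if "z \<in> cball a r" for z
    using hy[OF that] re norm_triangle_ineq[of "y a" "y z - y a"] by (simp add: ya)
  have holy: "(\<lambda>z. y z $ i) holomorphic_on cball a r" for i
  proof -
    have "(\<lambda>z. \<phi> z $ i) field_differentiable at z" if "z \<in> cball a r" for z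
      using der[OF zK[OF that]] by (auto simp: has_derivative_curve_iff field_differentiable_def)
    then have "(\<lambda>z. \<phi> z $ i) holomorphic_on cball a r"
      by (simp add: holomorphic_on_def field_differentiable_at_within)
    then show ?thesis by (auto simp: y_def intro!: holomorphic_intros)
  qed
  let ?z = "\<lambda>\<theta>. a + of_real r * cis \<theta>"
  have zc: "?z \<theta> \<in> cball a r" for \<theta> by (rule circle_point_in_cball[OF r(1)])
  have conty: "continuous_on {0..2*pi} (\<lambda>\<theta>. y (?z \<theta>))"
    by (intro continuous_on_vec_componentwise
        continuous_on_compose2[OF holomorphic_on_imp_continuous_on[OF holy] continuous_on_circle])
       (use zc in blast)
  have point: "p + (of_real r * cis \<theta>) *s b = \<phi> (?z \<theta>) + y (?z \<theta>)" for \<theta> by (simp add: y_def)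
  have contint: "(\<lambda>\<theta>. u (p + (of_real r * cis \<theta>) *s b)) integrable_on {0..2*pi}"
    using inT[OF zK[OF zc] yz[OF zc]] T(2)
    by (intro integrable_continuous_real continuous_on_compose2[OF contu]
        continuous_on_compose2[OF continuous_on_affine_curve[where S = UNIV]] continuous_intros)
       (auto simp: point)
  have i1: "((\<lambda>\<theta>. (norm (y (?z \<theta>)))\<^sup>2) has_integral integral {0..2*pi} (\<lambda>\<theta>. (norm (y (?z \<theta>)))\<^sup>2)) {0..2*pi}"
    by (intro integrable_integral integrable_continuous_real continuous_intros conty)
  have i1b: "integral {0..2*pi} (\<lambda>\<theta>. (norm (y (?z \<theta>)))\<^sup>2) \<le> 2 * pi * (norm ys)\<^sup>2 + 2 * pi * (e * r)\<^sup>2"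
  proof -
    have "integral {0..2*pi} (\<lambda>\<theta>. (norm (y (?z \<theta>) - y a))\<^sup>2) \<le> integral {0..2*pi} (\<lambda>\<theta>. (e * r)\<^sup>2)"
      by (intro integral_le integrable_continuous_real continuous_intros conty power_mono hy zc) auto
    then show ?thesis
      using holomorphic_curve_circle_mean_norm_sq[of y, OF holy r(1)] by (simp add: ya)
  qed
  have i2: "((\<lambda>\<theta>. (cmod (?z \<theta>))\<^sup>2) has_integral 2 * pi * ((cmod a)\<^sup>2 + r\<^sup>2)) {0..2*pi}"
  proof -
    have "integral {0..2*pi} (\<lambda>\<theta>. (cmod (?z \<theta>))\<^sup>2) = 2 * pi * ((cmod a)\<^sup>2 + r\<^sup>2)"
      using holomorphic_circle_mean_norm_sq[of "\<lambda>z. z" a r] r(1) by (simp add: norm_mult algebra_simps)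
    moreover have "(\<lambda>\<theta>. (cmod (?z \<theta>))\<^sup>2) integrable_on {0..2*pi}"
      by (intro integrable_continuous_real continuous_intros)
    ultimately show ?thesis by (metis integrable_integral)
  qed
  have i0: "((\<lambda>\<theta>. G k ws) has_integral 2 * pi * G k ws) {0..2*pi}"
    using has_integral_const_real[of "G k ws" 0 "2*pi"] by simp
  \<comment> \<open>Maximality of \<open>G k ws\<close> bounds \<open>u\<close> on the tangent
    circle. After averaging, the cross terms of both squared norms are gone and only corrections of
    order \<open>r\<^sup>2\<close> remain.\<close>
  have "integral {0..2*pi} (\<lambda>\<theta>. u (p + (of_real r * cis \<theta>) *s b)) \<le>
     ((2 * pi * G k ws - \<delta> * (2 * pi * ((cmod a)\<^sup>2 + r\<^sup>2))) + 2 * pi * H a) +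
       k * integral {0..2*pi} (\<lambda>\<theta>. (norm (y (?z \<theta>)))\<^sup>2)"
  proof (rule has_integral_le[OF integrable_integral[OF contint]])
    show "((\<lambda>\<theta>. ((G k ws - \<delta> * (cmod (?z \<theta>))\<^sup>2) + H (?z \<theta>)) + k * (norm (y (?z \<theta>)))\<^sup>2) has_integral
      ((2 * pi * G k ws - \<delta> * (2 * pi * ((cmod a)\<^sup>2 + r\<^sup>2))) + 2 * pi * H a) +
       k * integral {0..2*pi} (\<lambda>\<theta>. (norm (y (?z \<theta>)))\<^sup>2)) {0..2*pi}"
      using r by (intro has_integral_add has_integral_diff has_integral_mult_right i0 i1 i2 d3) auto
    fix \<theta>
    have "G k (?z \<theta>, y (?z \<theta>)) \<le> G k ws"
      by (rule ws(2)) (use zK[OF zc] yz[OF zc] in \<open>simp add: KK_def\<close>)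
    then show "u (p + (of_real r * cis \<theta>) *s b) \<le>
       ((G k ws - \<delta> * (cmod (?z \<theta>))\<^sup>2) + H (?z \<theta>)) + k * (norm (y (?z \<theta>)))\<^sup>2"
      unfolding point by (simp add: G_def)
  qed
  also have "\<dots> \<le> ((2 * pi * G k ws - \<delta> * (2 * pi * ((cmod a)\<^sup>2 + r\<^sup>2))) + 2 * pi * H a) +
       k * (2 * pi * (norm ys)\<^sup>2 + 2 * pi * (e * r)\<^sup>2)"
    using i1b k by (intro add_left_mono mult_left_mono) auto
  also have "\<dots> = 2 * pi * (G k ws - \<delta> * (cmod a)\<^sup>2 + H a + k * (norm ys)\<^sup>2 - \<delta> * r\<^sup>2 + (k * e\<^sup>2) * r\<^sup>2)"
    by (simp add: algebra_simps power_mult_distrib)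
  also have "\<dots> = 2 * pi * (u p - \<delta> * r\<^sup>2 / 2)"
    unfolding e(2) by (simp add: G_def a_ys_def p_b_def)
  finally have "integral {0..2*pi} (\<lambda>\<theta>. u (p + (of_real r * cis \<theta>) *s b)) \<le> 2 * pi * (u p - \<delta> * r\<^sup>2 / 2)" .
  moreover have "2 * pi * u p \<le> integral {0..2*pi} (\<lambda>\<theta>. u (p + (of_real r * cis \<theta>) *s b))"
    using d4(2)[of r] r(1,5) by (simp add: pos_le_divide_eq mult.commute)
  ultimately have "2 * pi * u p \<le> 2 * pi * (u p - \<delta> * r\<^sup>2 / 2)" by (rule order_trans[rotated])
  then have "u p \<le> u p - \<delta> * r\<^sup>2 / 2" by (simp only: mult_le_cancel_left_pos[of "2 * pi"] pi_gt_zero mult_pos_pos zero_less_numeral)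
  then show False using mult_pos_pos[OF \<delta> zero_less_power[OF r(1)], of 2] by simp
qed

section \<open>Large flow discs in unbounded domains\<close>

lemma flow_zero: "is_complex_flow V X \<Longrightarrow> X 0 z = z"
  by (simp add: is_complex_flow_def)

lemma flow_has_derivative:
  "is_complex_flow V X \<Longrightarrow> ((\<lambda>\<mu>. X \<mu> z) has_derivative (\<lambda>h. h *s V (X \<sigma> z))) (at \<sigma>)"
  by (simp add: is_complex_flow_def)

text \<open>\<open>circularlike\<close> covers imaginary times below \<open>pi / 2\<close> only.
  Splitting \<open>Im \<sigma>\<close> into \<open>n\<close> steps shorter than 1 and composing
  reaches every height; \<open>spirallike\<close> supplies the real part.\<close>

lemma spirallike_circularlike_halfplane:
  assumes V: "holo_map_on V UNIV" and X: "is_complex_flow V X"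
    and sp: "spirallike X D" and ci: "circularlike X D"
    and z: "z \<in> D" and \<sigma>: "Re \<sigma> \<ge> 0"
  shows "X \<sigma> z \<in> D"
proof -
  obtain n :: nat where n: "\<bar>Im \<sigma>\<bar> < real n" using reals_Archimedean2 by blast
  then have n0: "n > 0" by linarith
  define s where "s = Im \<sigma> / real n"
  have "\<bar>s\<bar> < 1" using n n0 by (simp add: s_def abs_divide)
  then have s: "- pi / 2 < s" "s < pi / 2" using pi_gt3 by linarith+
  have it: "X (of_nat m * (\<i> * of_real s)) y \<in> D" if "y \<in> D" for m y
  proof (induction m)
    case (Suc m)
    have "X (of_nat (Suc m) * (\<i> * of_real s)) y = X (\<i> * of_real s) (X (of_nat m * (\<i> * of_real s)) y)"
      by (simp add: algebra_simps flip: flow_add[OF V X])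
    also have "\<dots> \<in> D" using ci s Suc unfolding circularlike_def by blast
    finally show ?case .
  qed (use that flow_zero[OF X] in simp)
  have "\<sigma> = of_nat n * (\<i> * of_real s) + of_real (Re \<sigma>)"
    using n0 by (simp add: s_def complex_eq_iff)
  then have "X \<sigma> z = X (of_nat n * (\<i> * of_real s)) (X (of_real (Re \<sigma>)) z)"
    using flow_add[OF V X] by metis
  moreover have "X (of_real (Re \<sigma>)) z \<in> D" using sp z \<sigma> unfolding spirallike_def by blast
  ultimately show ?thesis using it by simp
qed

text \<open>A fixed point of the time-one map is fixed by all natural times, against convergence to
  0; a zero of \<open>V\<close> is such a point by uniqueness. The first conclusion yields two
  points that hyperbolicity would have to separate, the second a nonconstant flow disc through
  \<open>w\<close>.\<close>

lemma attracted_not_fixed: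
  fixes V :: "complex ^ 'n \<Rightarrow> complex ^ 'n"
  assumes V: "holo_map_on V UNIV" and X: "is_complex_flow V X"
    and lim: "((\<lambda>t. X (of_real t) w) \<longlongrightarrow> 0) at_top" and w: "w \<noteq> 0"
  shows "X 1 w \<noteq> w" "V w \<noteq> 0"
proof -
  show *: "X 1 w \<noteq> w"
  proof
    assume eq: "X 1 w = w"
    have "X (of_real (real n)) w = w" for n
    proof (induction n)
      case (Suc n)
      have "X (of_real (real (Suc n))) w = X 1 (X (of_real (real n)) w)"
        by (simp add: algebra_simps flip: flow_add[OF V X])
      then show ?case using Suc eq by simp
    qed (simp add: flow_zero[OF X])
    moreover have "(\<lambda>n. X (of_real (real n)) w) \<longlonglongrightarrow> 0"
      by (rule filterlim_compose[OF lim filterlim_real_sequentially])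
    ultimately show False using w by (simp add: LIMSEQ_const_iff)
  qed
  show "V w \<noteq> 0"
  proof
    assume "V w = 0"
    then have "X (of_real 1 * 1 + 0) w = w"
      by (intro holo_ode_unique[OF V, where c = 1 and x = "\<lambda>t. X (of_real t * 1 + 0) w" and y = "\<lambda>t. w"]
          flow_ray_has_vector_derivative[OF X]) (simp_all add: flow_zero[OF X])
    with * show False by simp
  qed
qed

lemma unbounded_exhausting_discs:
  fixes V :: "complex ^ 'n \<Rightarrow> complex ^ 'n"
  assumes V: "holo_map_on V UNIV" and X: "is_complex_flow V X"
    and lim: "\<And>z. ((\<lambda>t. X (of_real t) z) \<longlongrightarrow> 0) at_top"
    and D: "open D" "0 \<in> D" and sp: "spirallike X D" and ci: "circularlike X D"
    and unb: "\<not> bounded D"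
  obtains w ws where "w \<in> D" "w \<noteq> 0" "ws \<longlonglongrightarrow> w"
    "\<And>R. \<forall>\<^sub>F n in sequentially. \<forall>\<sigma>. cmod \<sigma> \<le> R \<longrightarrow> X \<sigma> (ws n) \<in> D"
proof -
  obtain r where r: "r > 0" "cball 0 r \<subseteq> D" using D open_contains_cball by blast
  have "\<exists>z t. z \<in> D \<and> norm z > real n \<and> t \<ge> 0 \<and> norm (X (of_real t) z) = r" for n
  proof -
    \<comment> \<open>The summand \<open>r\<close> puts the starting point outside the sphere of
      radius \<open>r\<close>, so that its orbit has to cross it.\<close>
    obtain z where z: "z \<in> D" "norm z > real n + r"
      using unb unfolding bounded_iff by (meson not_le)
    have "\<forall>\<^sub>F t in at_top. norm (X (of_real t) z) < r"
      using tendstoD[OF lim r(1), of z] by (simp add: dist_norm)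
    then obtain T where T: "\<And>t. t \<ge> T \<Longrightarrow> norm (X (of_real t) z) < r"
      by (auto simp: eventually_at_top_linorder)
    have "\<exists>t\<ge>0. t \<le> max T 0 \<and> norm (X (of_real t) z) = r"
    proof (rule IVT2')
      show "norm (X (of_real (max T 0)) z) \<le> r" using T[of "max T 0"] by simp
      show "r \<le> norm (X (of_real 0) z)" using z by (simp add: flow_zero[OF X])
      show "continuous_on {0..max T 0} (\<lambda>t. norm (X (of_real t) z))"
        by (intro continuous_intros continuous_on_compose2[OF flow_continuous_on[OF X, where S = UNIV]]) auto
    qed auto
    then show ?thesis using z r(1) by (metis add_less_cancel_left add.right_neutral less_trans)
  qed
  then obtain zs ts where zt: "\<And>n. zs n \<in> D" "\<And>n. norm (zs n) > real n" "\<And>n. ts n \<ge> (0::real)"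
    "\<And>n. norm (X (of_real (ts n)) (zs n)) = r" by metis
  define vs where "vs n = X (of_real (ts n)) (zs n)" for n
  have "compact (sphere (0 :: complex ^ 'n) r)" by simp
  moreover have "\<forall>n. vs n \<in> sphere 0 r" using zt by (simp add: vs_def)
  ultimately obtain w \<rho> where w: "w \<in> sphere 0 r" "strict_mono \<rho>" "(vs \<circ> \<rho>) \<longlonglongrightarrow> w"
    unfolding compact_def by blast
  show ?thesis
  proof (rule that[of w "vs \<circ> \<rho>"])
    show "w \<in> D" "w \<noteq> 0" using w(1) r by (auto simp: subset_iff)
    show "(vs \<circ> \<rho>) \<longlonglongrightarrow> w" by fact
    fix R
    obtain C where C: "C > 0" "\<And>\<sigma> z. cmod \<sigma> \<le> R \<Longrightarrow> norm (z - w) * C < 1 \<Longrightarrow>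
      norm (X \<sigma> z - X \<sigma> w) \<le> norm (z - w) * C"
      using flow_locally_Lipschitz[OF V X] by blast
    have "bounded ((\<lambda>\<sigma>. X \<sigma> w) ` cball 0 R)"
      by (intro compact_imp_bounded compact_continuous_image flow_continuous_on[OF X] compact_cball)
    then obtain B where B: "\<And>\<sigma>. cmod \<sigma> \<le> R \<Longrightarrow> norm (X \<sigma> w) \<le> B"
      unfolding bounded_iff by fastforce
    have "\<forall>\<^sub>F n in sequentially. dist ((vs \<circ> \<rho>) n) w < 1 / C"
      by (rule tendstoD[OF w(3)]) (use C in simp)
    moreover have "\<forall>\<^sub>F n in sequentially. real n > B + 1"
      by real_asymp
    ultimately show "\<forall>\<^sub>F n in sequentially. \<forall>\<sigma>. cmod \<sigma> \<le> R \<longrightarrow> X \<sigma> ((vs \<circ> \<rho>) n) \<in> D"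
    proof eventually_elim
      case (elim n)
      define t z where "t = ts (\<rho> n)" "z = zs (\<rho> n)"
      have v: "(vs \<circ> \<rho>) n = X (of_real t) z" by (simp add: vs_def t_z_def)
      have close: "norm (X (of_real t) z - w) * C < 1" using elim(1) C(1) by (simp add: dist_norm field_simps flip: v)
      \<comment> \<open>Otherwise flowing back by \<open>t\<close> takes the crossing point to
        within distance 1 of \<open>X (- of_real t) w\<close>, hence into the ball of radius
        \<open>B + 1\<close>; but the point reached is \<open>z\<close>, whose norm exceeds
        \<open>n\<close>.\<close>
      have t: "t > R"
      proof (rule ccontr)
        assume "\<not> t > R"
        then have tR: "cmod (- of_real t) \<le> R" using zt(3) by (simp add: t_z_def)
        have "X (- of_real t) (X (of_real t) z) = z"
          by (simp add: flow_zero[OF X] flip: flow_add[OF V X])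
        then have "norm (z - X (- of_real t) w) < 1" using C(2)[OF tR close] close by simp
        then have "norm z < B + 1" using B[OF tR] norm_triangle_ineq2[of z "X (- of_real t) w"] by simp
        moreover have "norm z > real n"
          using zt(2)[of "\<rho> n"] seq_suble[OF w(2), of n] by (simp add: t_z_def)
        ultimately show False using elim(2) by simp
      qed
      show ?case
      proof (intro allI impI)
        fix \<sigma> assume "cmod \<sigma> \<le> R"
        then have "Re (\<sigma> + of_real t) \<ge> 0" using t abs_Re_le_cmod[of \<sigma>] by simp
        then have "X (\<sigma> + of_real t) z \<in> D"
          by (rule spirallike_circularlike_halfplane[OF V X sp ci zt(1)[of "\<rho> n", folded t_z_def(2)]])
        then show "X \<sigma> ((vs \<circ> \<rho>) n) \<in> D" unfolding v by (simp add: flow_add[OF V X])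
      qed
    qed
  qed
qed

section \<open>Limits along flow discs, three circles and the core\<close>

lemma flow_tendsto:
  fixes V :: "complex ^ 'n \<Rightarrow> complex ^ 'n"
  assumes V: "holo_map_on V UNIV" and X: "is_complex_flow V X" and ws: "ws \<longlonglongrightarrow> w"
  shows "(\<lambda>n. X \<sigma> (ws n)) \<longlonglongrightarrow> X \<sigma> w"
proof -
  obtain C where C: "C > 0" "\<And>\<sigma>' z. cmod \<sigma>' \<le> cmod \<sigma> \<Longrightarrow> norm (z - w) * C < 1 \<Longrightarrow>
      norm (X \<sigma>' z - X \<sigma>' w) \<le> norm (z - w) * C"
    using flow_locally_Lipschitz[OF V X] by blast
  have lim0: "(\<lambda>n. norm (ws n - w) * C) \<longlonglongrightarrow> 0"
    using tendsto_mult_right[OF tendsto_norm_zero[OF LIM_zero[OF ws]], of C] by simp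
  then have "\<forall>\<^sub>F n in sequentially. norm (ws n - w) * C < 1"
    by (rule order_tendstoD) simp
  then have "\<forall>\<^sub>F n in sequentially. norm (X \<sigma> (ws n) - X \<sigma> w) \<le> norm (ws n - w) * C"
    by eventually_elim (rule C(2)[OF order_refl])
  then show ?thesis by (rule LIM_zero_cancel[OF Lim_null_comparison[OF _ lim0]])
qed

text \<open>On \<open>ball a (cmod a)\<close> the quotient \<open>z / a\<close> has positive real
  part, so the principal branch \<open>Ln (z / a)\<close> is holomorphic there, and its real part is
  \<open>ln (cmod z) - ln (cmod a)\<close>.\<close>

lemma mean_value_at_ln_cmod:
  assumes a: "a \<noteq> 0" and "\<rho> > 0"
  shows "mean_value_at (\<lambda>z. A + c * ln (cmod z / \<rho>)) a"
proof (rule mean_value_at_Re_holomorphic)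
  let ?f = "\<lambda>z. of_real (A + c * (ln (cmod a) - ln \<rho>)) + of_real c * Ln (z / a)"
  have nz: "Re (z / a) > 0" if "z \<in> ball a (cmod a)" for z
  proof -
    have "z / a - 1 = (z - a) / a" using a by (simp add: field_simps)
    then have "cmod (z / a - 1) = cmod (z - a) / cmod a" by (simp only: norm_divide)
    also have "\<dots> < 1" using that a by (simp add: dist_norm norm_minus_commute)
    finally show ?thesis using abs_Re_le_cmod[of "z / a - 1"] by simp
  qed
  show "?f holomorphic_on ball a (cmod a)"
    using a by (intro holomorphic_intros) (use nz in \<open>force simp: complex_nonpos_Reals_iff\<close>)+
  fix z assume z: "z \<in> ball a (cmod a)"
  then have z0: "z \<noteq> 0" by auto
  then have "Re (Ln (z / a)) = ln (cmod z) - ln (cmod a)" "ln (cmod z / \<rho>) = ln (cmod z) - ln \<rho>"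
    using assms by (simp_all add: norm_divide ln_div)
  then show "A + c * ln (cmod z / \<rho>) = Re (?f z)"
    by (simp only: plus_complex.sel times_complex.sel Re_complex_of_real Im_complex_of_real)
       (simp add: algebra_simps)
qed (use a in auto)

text \<open>Hadamard's three circles inequality: the logarithmic majorant is \<open>A\<close> on the
  inner circle and \<open>max A M\<close> on the outer one, and the maximum principle carries the
  comparison into the annulus.\<close>

lemma psh_annulus_bound:
  fixes u :: "complex ^ 'n \<Rightarrow> real"
  assumes D: "open D" and psh: "psh_on D u" and bdd: "\<And>z. z \<in> D \<Longrightarrow> u z \<le> M"
    and der: "\<And>\<zeta>. (\<phi> has_derivative (\<lambda>h. h *s \<phi>' \<zeta>)) (at \<zeta>)"
    and sub: "\<And>\<zeta>. cmod \<zeta> \<le> R \<Longrightarrow> \<phi> \<zeta> \<in> D"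
    and \<rho>: "0 < \<rho>" "\<rho> < R" and inner: "\<And>\<zeta>. cmod \<zeta> = \<rho> \<Longrightarrow> u (\<phi> \<zeta>) \<le> A"
    and \<zeta>: "\<rho> \<le> cmod \<zeta>" "cmod \<zeta> \<le> R"
  shows "u (\<phi> \<zeta>) \<le> A + max 0 (M - A) / ln (R / \<rho>) * ln (cmod \<zeta> / \<rho>)"
proof -
  define c where "c = max 0 (M - A) / ln (R / \<rho>)"
  define K where "K = cball 0 R - ball (0 :: complex) \<rho>"
  have lnR: "ln (R / \<rho>) > 0" using \<rho> by simp
  have fr: "frontier K \<subseteq> {z. cmod z = R \<or> cmod z = \<rho>}"
  proof -
    have "ball 0 R - cball 0 \<rho> \<subseteq> interior K"
      by (rule interior_maximal) (auto simp: K_def)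
    moreover have "closed K" unfolding K_def by (intro closed_Diff) auto
    ultimately have "frontier K \<subseteq> K - (ball 0 R - cball 0 \<rho>)" by (auto simp: frontier_def)
    then show ?thesis by (auto simp: K_def)
  qed
  have "u (\<phi> \<zeta>) \<le> A + c * ln (cmod \<zeta> / \<rho>)"
  proof (rule psh_maximum_principle[OF D psh, where K = K and \<phi>' = \<phi>'])
    show "compact K" unfolding K_def by (intro compact_diff) auto
    show "\<phi> ` K \<subseteq> D" using sub by (auto simp: K_def)
    show "continuous_on K (\<lambda>\<zeta>. A + c * ln (cmod \<zeta> / \<rho>))"
      using \<rho> by (intro continuous_intros) (auto simp: K_def)
    show "mean_value_at (\<lambda>\<zeta>. A + c * ln (cmod \<zeta> / \<rho>)) a" if "a \<in> interior K" for a
      by (rule mean_value_at_ln_cmod) (use subsetD[OF interior_subset that] \<rho> in \<open>auto simp: K_def\<close>)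
    fix z assume "z \<in> frontier K"
    then consider "cmod z = R" | "cmod z = \<rho>" using fr by auto
    then show "u (\<phi> z) \<le> A + c * ln (cmod z / \<rho>)"
    proof cases
      case 1
      then have "u (\<phi> z) \<le> M" by (intro bdd sub) simp
      then show ?thesis using lnR by (simp add: c_def 1)
    next
      case 2
      then show ?thesis using inner[of z] \<rho> by simp
    qed
  qed (use der \<zeta> in \<open>auto simp: K_def\<close>)
  then show ?thesis by (simp add: c_def)
qed

text \<open>On a small inner circle \<open>u\<close> is at most \<open>u w + e\<close> by
  continuity. For fixed \<open>R\<close> the three circles bound on the disc at \<open>ws n\<close>
  passes to the limit in \<open>n\<close>; as \<open>R\<close> grows, the coefficient of its
  logarithm tends to 0.\<close>

lemma psh_le_along_limit_orbit:
  fixes V :: "complex ^ 'n \<Rightarrow> complex ^ 'n"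
  assumes V: "holo_map_on V UNIV" and X: "is_complex_flow V X"
    and D: "open D" and w: "w \<in> D" and ws: "ws \<longlonglongrightarrow> w"
    and disc: "\<And>R. \<forall>\<^sub>F n in sequentially. \<forall>\<sigma>. cmod \<sigma> \<le> R \<longrightarrow> X \<sigma> (ws n) \<in> D"
    and psh: "psh_on D u" and bdd: "\<And>z. z \<in> D \<Longrightarrow> u z \<le> M"
    and \<sigma>: "X \<sigma> w \<in> D"
  shows "u (X \<sigma> w) \<le> u w"
proof (cases "\<sigma> = 0")
  case False
  have contu: "continuous_on D u" using psh by (simp add: psh_on_def)
  show ?thesis
  proof (rule field_le_epsilon)
    fix e :: real assume e: "e > 0"
    have "isCont u w" using contu D w continuous_on_eq_continuous_at by blast
    then obtain d where d: "d > 0" "\<And>z. dist z w < d \<Longrightarrow> dist (u z) (u w) < e"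
      using e unfolding continuous_at_eps_delta by metis
    have "isCont (\<lambda>\<mu>. X \<mu> w) 0" using flow_has_derivative[OF X] has_derivative_continuous by blast
    then obtain s where s: "s > 0" "\<And>\<mu>. cmod \<mu> < s \<Longrightarrow> dist (X \<mu> w) w < d / 2"
      using d unfolding continuous_at_eps_delta
      by (metis dist_0_norm dist_commute flow_zero[OF X] half_gt_zero)
    \<comment> \<open>The second argument of \<open>min\<close> makes \<open>\<sigma>\<close> lie in
      the annulus.\<close>
    define \<rho> where "\<rho> = min (s / 2) (cmod \<sigma>)"
    have \<rho>: "\<rho> > 0" "\<rho> < s" "\<rho> \<le> cmod \<sigma>" using s False by (auto simp: \<rho>_def)
    obtain C where C: "C > 0" "\<And>\<mu> z. cmod \<mu> \<le> \<rho> \<Longrightarrow> norm (z - w) * C < 1 \<Longrightarrow>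
      norm (X \<mu> z - X \<mu> w) \<le> norm (z - w) * C"
      using flow_locally_Lipschitz[OF V X] by blast
    define A where "A = u w + e"
    have ev: "\<forall>\<^sub>F n in sequentially. \<forall>\<mu>. cmod \<mu> = \<rho> \<longrightarrow> u (X \<mu> (ws n)) \<le> A"
    proof -
      have "\<forall>\<^sub>F n in sequentially. dist (ws n) w < min 1 (d / 2) / C"
        by (rule tendstoD[OF ws]) (use C d in simp)
      then show ?thesis
      proof eventually_elim
        case (elim n)
        then have n: "norm (ws n - w) * C < min 1 (d / 2)"
          using C(1) by (simp add: dist_norm pos_less_divide_eq)
        show ?case
        proof (intro allI impI)
          fix \<mu> assume \<mu>: "cmod \<mu> = \<rho>"
          have "dist (X \<mu> (ws n)) (X \<mu> w) < d / 2" using C(2)[of \<mu> "ws n"] \<mu> n by (simp add: dist_norm)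
          moreover have "dist (X \<mu> w) w < d / 2" using s(2)[of \<mu>] \<mu> \<rho> by simp
          ultimately have "dist (X \<mu> (ws n)) w < d" using dist_triangle[of "X \<mu> (ws n)" w "X \<mu> w"] by linarith
          then have "dist (u (X \<mu> (ws n))) (u w) < e" by (rule d)
          then show "u (X \<mu> (ws n)) \<le> A" by (auto simp: A_def dist_real_def)
        qed
      qed
    qed
    have lim: "(\<lambda>n. u (X \<sigma> (ws n))) \<longlonglongrightarrow> u (X \<sigma> w)"
      using contu D \<sigma> flow_tendsto[OF V X ws]
      by (metis continuous_on_eq_continuous_at isCont_tendsto_compose)
    have bound: "u (X \<sigma> w) \<le> A + max 0 (M - A) / ln (R / \<rho>) * ln (cmod \<sigma> / \<rho>)" if R: "R > cmod \<sigma>" for R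
    proof (rule tendsto_upperbound[OF lim])
      show "\<forall>\<^sub>F n in sequentially. u (X \<sigma> (ws n)) \<le> A + max 0 (M - A) / ln (R / \<rho>) * ln (cmod \<sigma> / \<rho>)"
        using ev disc[of R]
      proof eventually_elim
        case (elim n)
        show ?case
          by (rule psh_annulus_bound[OF D psh bdd flow_has_derivative[OF X], where R = R])
             (use elim R \<rho> in auto)
      qed
    qed simp
    have "((\<lambda>R. A + max 0 (M - A) / ln (R / \<rho>) * ln (cmod \<sigma> / \<rho>)) \<longlongrightarrow> A + 0 * ln (cmod \<sigma> / \<rho>)) at_top"
    proof (intro tendsto_add tendsto_mult tendsto_const)
      have "LIM R at_top. ln (R / \<rho>) :> at_top" using \<rho>(1) by real_asymp
      then show "((\<lambda>R. max 0 (M - A) / ln (R / \<rho>)) \<longlongrightarrow> 0) at_top"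
        by (rule real_tendsto_divide_at_top[OF tendsto_const])
    qed
    moreover have "\<forall>\<^sub>F R in at_top. u (X \<sigma> w) \<le> A + max 0 (M - A) / ln (R / \<rho>) * ln (cmod \<sigma> / \<rho>)"
      using eventually_gt_at_top[of "cmod \<sigma>"] by eventually_elim (rule bound)
    ultimately have "u (X \<sigma> w) \<le> A + 0 * ln (cmod \<sigma> / \<rho>)"
      by (rule tendsto_lowerbound) simp
    then show "u (X \<sigma> w) \<le> u w + e" by (simp add: A_def)
  qed
qed (simp add: flow_zero[OF X])

lemma inner_vec_complex_eq_Re: "(v :: complex ^ 'n) \<bullet> w = Re (\<Sum>i\<in>UNIV. v $ i * cnj (w $ i))"
  by (simp add: inner_vec_def inner_complex_def)

text \<open>Strictness would leave a plurisubharmonic function after subtracting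
  \<open>\<epsilon> * (norm z)\<^sup>2\<close>. Along the curve,
  \<open>(norm (\<phi> z))\<^sup>2\<close> is a harmonic part plus
  \<open>(norm (\<phi> z - w))\<^sup>2\<close>. As the latter is bounded below on a small circle,
  the difference lies there at least \<open>\<kappa>\<close> under a harmonic function that equals
  it at the centre.\<close>

lemma not_strictly_psh_at_if_le_along_curve:
  fixes u :: "complex ^ 'n \<Rightarrow> real"
  assumes der: "\<And>\<zeta>. (\<phi> has_derivative (\<lambda>h. h *s \<phi>' \<zeta>)) (at \<zeta>)" and nz: "\<phi>' 0 \<noteq> 0"
    and le: "\<forall>\<^sub>F \<zeta> in nhds 0. u (\<phi> \<zeta>) \<le> u (\<phi> 0)"
  shows "\<not> strictly_psh_at D u (\<phi> 0)"
proof
  define w where "w = \<phi> 0"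
  assume "strictly_psh_at D u (\<phi> 0)"
  then obtain U \<epsilon> where U: "open U" "w \<in> U" and \<epsilon>: "\<epsilon> > 0" and psh: "psh_on U (\<lambda>z. u z - \<epsilon> * (norm z)\<^sup>2)"
    unfolding strictly_psh_at_def w_def by blast
  have cont: "continuous_on S \<phi>" for S
    using der by (meson continuous_at_imp_continuous_on has_derivative_continuous)
  have hol: "(\<lambda>z. \<phi> z $ i) holomorphic_on S" for i S
    using der by (auto simp: has_derivative_curve_iff holomorphic_on_def field_differentiable_def
        intro: has_field_derivative_at_within)
  have "open (\<phi> -` U)" using open_vimage[OF U(1) cont] .
  then have "\<forall>\<^sub>F \<zeta> in nhds 0. \<phi> \<zeta> \<in> U" using U(2) unfolding eventually_nhds w_def by auto
  \<comment> \<open>The linearisation error is at most half the size of the linear term, so the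
    curve does not return to \<open>w\<close> near 0.\<close>
  moreover have "\<forall>\<^sub>F \<zeta> in nhds 0. \<zeta> \<noteq> 0 \<longrightarrow> \<phi> \<zeta> \<noteq> w"
  proof -
    obtain d where d: "d > 0" "\<And>z. cmod z < d \<Longrightarrow> norm (\<phi> z - \<phi> 0 - z *s \<phi>' 0) \<le> norm (\<phi>' 0) / 2 * cmod z"
      using der[of 0] nz unfolding has_derivative_at_alt by (metis diff_zero half_gt_zero zero_less_norm_iff)
    have "\<phi> z \<noteq> w" if "cmod z < d" "z \<noteq> 0" for z
    proof
      assume "\<phi> z = w"
      then have "cmod z * norm (\<phi>' 0) \<le> norm (\<phi>' 0) / 2 * cmod z"
        using d(2)[OF that(1)] by (simp add: w_def norm_vector_smult)
      then show False using nz that(2) by (simp add: field_simps)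
    qed
    with d(1) show ?thesis unfolding eventually_nhds_metric by (auto simp: dist_norm)
  qed
  ultimately have "\<forall>\<^sub>F \<zeta> in nhds 0. \<phi> \<zeta> \<in> U \<and> (\<zeta> \<noteq> 0 \<longrightarrow> \<phi> \<zeta> \<noteq> w) \<and> u (\<phi> \<zeta>) \<le> u (\<phi> 0)"
    using le by eventually_elim auto
  then obtain d where d: "d > 0" "\<And>z. cmod z < d \<Longrightarrow> \<phi> z \<in> U \<and> (z \<noteq> 0 \<longrightarrow> \<phi> z \<noteq> w) \<and> u (\<phi> z) \<le> u w"
    unfolding eventually_nhds_metric w_def by (auto simp: dist_norm)
  define r where "r = d / 2"
  have r: "r > 0" "r < d" using d(1) by (auto simp: r_def)
  have "of_real r \<in> sphere (0 :: complex) r" using r by simp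
  then have "sphere (0 :: complex) r \<noteq> {}" by blast
  moreover have "continuous_on (sphere 0 r) (\<lambda>z. norm (\<phi> z - w))" by (intro continuous_intros cont)
  ultimately obtain zm where zm: "zm \<in> sphere 0 r" "\<And>z. z \<in> sphere 0 r \<Longrightarrow> norm (\<phi> zm - w) \<le> norm (\<phi> z - w)"
    using continuous_attains_inf[OF compact_sphere] by blast
  define \<kappa> where "\<kappa> = \<epsilon> * (norm (\<phi> zm - w))\<^sup>2"
  have \<kappa>: "\<kappa> > 0" using d(2)[of zm] zm(1) r \<epsilon> by (auto simp: \<kappa>_def)
  define H where "H z = u w - \<epsilon> * (norm w)\<^sup>2 - 2 * \<epsilon> * ((\<phi> z - w) \<bullet> w) - \<kappa>" for z
  have sq: "(norm (\<phi> z))\<^sup>2 = (norm w)\<^sup>2 + 2 * ((\<phi> z - w) \<bullet> w) + (norm (\<phi> z - w))\<^sup>2" for z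
    by (simp add: power2_norm_eq_inner algebra_simps inner_commute)
  have "u (\<phi> 0) - \<epsilon> * (norm (\<phi> 0))\<^sup>2 \<le> H 0"
  proof (rule psh_maximum_principle[OF U(1) psh compact_cball[of 0 r], where \<phi>' = \<phi>'])
    show "\<phi> ` cball 0 r \<subseteq> U" using d(2) r by (auto simp: image_subset_iff)
    show "continuous_on (cball 0 r) H" unfolding H_def by (intro continuous_intros cont)
    \<comment> \<open>The real inner product with \<open>w\<close> is the real part of the Hermitian
      one, hence of a holomorphic function of \<open>z\<close>.\<close>
    show "mean_value_at H a" for a
    proof (rule mean_value_at_Re_holomorphic[where R = 1 and
        f = "\<lambda>z. of_real (u w - \<epsilon> * (norm w)\<^sup>2 - \<kappa>) -
          of_real (2 * \<epsilon>) * (\<Sum>i\<in>UNIV. (\<phi> z $ i - w $ i) * cnj (w $ i))"])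
      show "(\<lambda>z. of_real (u w - \<epsilon> * (norm w)\<^sup>2 - \<kappa>) -
          of_real (2 * \<epsilon>) * (\<Sum>i\<in>UNIV. (\<phi> z $ i - w $ i) * cnj (w $ i))) holomorphic_on ball a 1"
        by (intro holomorphic_intros hol)
    qed (simp_all add: H_def inner_vec_complex_eq_Re)
    fix z assume "z \<in> frontier (cball (0::complex) r)"
    then have z: "z \<in> sphere 0 r" using r by (simp add: frontier_cball)
    then have "\<epsilon> * (norm (\<phi> zm - w))\<^sup>2 \<le> \<epsilon> * (norm (\<phi> z - w))\<^sup>2"
      using zm(2) \<epsilon> by (intro mult_left_mono power_mono) auto
    moreover have "u (\<phi> z) \<le> u w" using d(2)[of z] z r by simp
    ultimately show "u (\<phi> z) - \<epsilon> * (norm (\<phi> z))\<^sup>2 \<le> H z"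
      unfolding H_def \<kappa>_def sq by (simp add: algebra_simps)
  qed (use der r in auto)
  then show False using \<kappa> by (simp add: H_def w_def)
qed

section \<open>Invariant distances\<close>

lemma holo_fun_on_comp_disc:
  assumes f: "holo_fun_on f D" and \<phi>: "holo_disc \<phi>" and sub: "\<phi> ` ball 0 1 \<subseteq> D"
  shows "(\<lambda>\<zeta>. f (\<phi> \<zeta>)) holomorphic_on ball 0 1"
proof -
  have "(\<lambda>\<zeta>. f (\<phi> \<zeta>)) field_differentiable at \<zeta>" if \<zeta>: "\<zeta> \<in> ball 0 1" for \<zeta>
  proof (rule holo_fun_on_comp_curve[OF f])
    show "(\<phi> has_derivative (\<lambda>h. h *s (\<chi> i. deriv (\<lambda>\<zeta>. \<phi> \<zeta> $ i) \<zeta>))) (at \<zeta>)"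
      using \<phi> \<zeta> by (auto simp: has_derivative_curve_iff holo_disc_def intro!: holomorphic_derivI[where S = "ball 0 1"])
  qed (use sub \<zeta> in blast)
  then show ?thesis by (simp add: holomorphic_on_def field_differentiable_at_within)
qed

lemma holo_fun_on_const: "holo_fun_on (\<lambda>z. c) S"
  unfolding holo_fun_on_def by (intro ballI exI[of _ "\<lambda>h. 0"]) auto

lemma holo_fun_on_coord_scale: "holo_fun_on (\<lambda>z. c * z $ i) S"
  unfolding holo_fun_on_def
  by (intro ballI exI[of _ "\<lambda>h. c * h $ i"] conjI bounded_linear_imp_has_derivative
      bounded_linear_const_mult bounded_linear_vec_nth) (simp add: algebra_simps)

section \<open>The Poincare distance of the disc and holomorphic discs in domains\<close>

lemma artanh_ge_half:
  fixes x :: real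
  assumes "0 \<le> x" "x < 1"
  shows "x / 2 \<le> artanh x"
proof -
  have "ln (1 - x) \<le> - x" using ln_add_one_self_le_self2[of "- x"] assms by simp
  moreover have "ln (1 + x) \<ge> 0" using assms by (intro ln_ge_zero) simp
  ultimately have "x \<le> ln (1 + x) - ln (1 - x)" by linarith
  then show ?thesis using assms by (simp add: artanh_def ln_div)
qed

lemma artanh_nonneg: "0 \<le> x \<Longrightarrow> x < 1 \<Longrightarrow> 0 \<le> artanh (x::real)"
  using artanh_ge_half[of x] by simp

lemma artanh_mono_real: "0 \<le> x \<Longrightarrow> x \<le> y \<Longrightarrow> y < 1 \<Longrightarrow> artanh x \<le> artanh (y::real)"
  unfolding artanh_def by (simp add: frac_le)

lemma poincare_0_left: "poincare 0 t = artanh (cmod t)"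
  by (simp add: poincare_def)

lemma poincare_eq_Moebius: "poincare a b = artanh (cmod (Moebius_function 0 b a))"
  by (simp add: poincare_def Moebius_function_simple)

lemma poincare_pos:
  assumes "cmod a < 1" "cmod b < 1" "a \<noteq> b"
  shows "poincare a b > 0"
proof -
  have "cmod (cnj b * a) < 1" using assms norm_mult_less[of "cnj b" 1 a 1] by simp
  then have "1 - cnj b * a \<noteq> 0" by auto
  then have "cmod (Moebius_function 0 b a) > 0" using assms by (simp add: Moebius_function_simple)
  moreover have "cmod (Moebius_function 0 b a) < 1" by (rule Moebius_function_norm_lt_1[OF assms(2,1)])
  ultimately show ?thesis
    unfolding poincare_eq_Moebius using artanh_ge_half[of "cmod (Moebius_function 0 b a)"] by linarith
qed

text \<open>The Moebius map taking \<open>h 0\<close> to 0 reduces this to the Schwarz lemma. It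
  will bound all competitors in the Caratheodory supremum.\<close>

lemma Schwarz_Pick_poincare:
  assumes h: "h holomorphic_on ball 0 1" and sub: "h ` ball 0 1 \<subseteq> ball 0 1" and t: "t \<in> ball 0 1"
  shows "poincare (h t) (h 0) \<le> artanh (cmod t)"
proof -
  let ?k = "\<lambda>\<zeta>. Moebius_function 0 (h 0) (h \<zeta>)"
  have lt: "cmod (h z) < 1" if "cmod z < 1" for z using sub that by (auto simp: image_subset_iff)
  have "cmod (?k t) \<le> cmod t"
  proof (rule Schwarz_Lemma)
    have "(Moebius_function 0 (h 0) \<circ> h) holomorphic_on ball 0 1"
      by (rule holomorphic_on_compose_gen[OF h Moebius_function_holomorphic sub]) (simp add: lt)
    then show "?k holomorphic_on ball 0 1" by (simp add: o_def)
    show "cmod (?k z) < 1" if "cmod z < 1" for z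
      by (rule Moebius_function_norm_lt_1) (use lt that in auto)
  qed (use t in \<open>auto simp: Moebius_function_eq_zero\<close>)
  then show ?thesis using t unfolding poincare_eq_Moebius by (intro artanh_mono_real) auto
qed

text \<open>Euclidean variant of Schwarz-Pick: \<open>(h - h 0) / 2\<close> is a self-map of the
  disc fixing 0, which costs a factor 2, and \<open>artanh_ge_half\<close> costs another. Euclidean
  differences telescope along chains, which suits the Kobayashi distance.\<close>

lemma holomorphic_disc_dist_bound:
  assumes h: "h holomorphic_on ball 0 1" and sub: "h ` ball 0 1 \<subseteq> ball 0 1" and t: "t \<in> ball 0 1"
  shows "cmod (h 0 - h t) / 4 \<le> artanh (cmod t)"
proof -
  have lt: "cmod (h z) < 1" if "cmod z < 1" for z using sub that by (auto simp: image_subset_iff)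
  have "cmod ((h t - h 0) / 2) \<le> cmod t"
  proof (rule Schwarz_Lemma[where f = "\<lambda>z. (h z - h 0) / 2"])
    show "(\<lambda>z. (h z - h 0) / 2) holomorphic_on ball 0 1" by (intro holomorphic_intros h) auto
    show "cmod ((h z - h 0) / 2) < 1" if "cmod z < 1" for z
      using norm_triangle_ineq4[of "h z" "h 0"] lt[OF that] lt[of 0] by (simp add: norm_divide)
  qed (use t in auto)
  then show ?thesis using artanh_ge_half[of "cmod t"] t by (simp add: norm_divide norm_minus_commute)
qed

text \<open>The coordinates of a polynomial path have real polynomials as real and imaginary parts;
  inserting a complex variable into these gives an entire curve extending the path.\<close>

lemma polynomial_function_complexification:
  fixes g :: "real \<Rightarrow> complex ^ 'n"
  assumes g: "polynomial_function g"
  obtains \<Phi> where "\<And>i. (\<lambda>\<zeta>. \<Phi> \<zeta> $ i) holomorphic_on UNIV" "\<And>t. \<Phi> (of_real t) = g t"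
proof -
  have "\<exists>p. p holomorphic_on UNIV \<and> (\<forall>t. p (of_real t) = g t $ i)" for i
  proof -
    have "bounded_linear (\<lambda>v :: complex ^ 'n. Re (v $ i))" "bounded_linear (\<lambda>v :: complex ^ 'n. Im (v $ i))"
      by (rule bounded_linear_compose[OF bounded_linear_Re bounded_linear_vec_nth]
        bounded_linear_compose[OF bounded_linear_Im bounded_linear_vec_nth])+
    then have "real_polynomial_function (\<lambda>t. Re (g t $ i))" "real_polynomial_function (\<lambda>t. Im (g t $ i))"
      using g by (auto simp: polynomial_function_def o_def)
    then obtain a n b m where ab: "(\<lambda>t. Re (g t $ i)) = (\<lambda>t. \<Sum>k\<le>n. a k * t ^ k)"
      "(\<lambda>t. Im (g t $ i)) = (\<lambda>t. \<Sum>k\<le>m. b k * t ^ k)"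
      unfolding real_polynomial_function_iff_sum by blast
    define p where "p \<zeta> = (\<Sum>k\<le>n. of_real (a k) * \<zeta> ^ k) + \<i> * (\<Sum>k\<le>m. of_real (b k) * \<zeta> ^ k)" for \<zeta> :: complex
    have "p holomorphic_on UNIV" unfolding p_def by (intro holomorphic_intros)
    moreover have "p (of_real t) = g t $ i" for t
    proof -
      have "p (of_real t) = of_real (Re (g t $ i)) + \<i> * of_real (Im (g t $ i))"
        unfolding fun_cong[OF ab(1)] fun_cong[OF ab(2)] by (simp add: p_def)
      then show ?thesis by (simp add: complex_eq_iff)
    qed
    ultimately show ?thesis by blast
  qed
  then obtain p where p: "\<And>i. p i holomorphic_on UNIV" "\<And>i t. p i (of_real t) = g t $ i" by metis
  show ?thesis by (rule that[of "\<lambda>\<zeta>. \<chi> i. p i \<zeta>"]) (use p in \<open>auto simp: vec_eq_iff\<close>)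
qed

text \<open>This makes the infimum defining the Lempert function range over a nonempty set; on the empty
  set \<open>Inf\<close> would be an unspecified real number.\<close>

lemma domain_holo_disc_through:
  assumes D: "domain D" and z: "z \<in> D" and w: "w \<in> D"
  obtains t \<phi> where "t \<in> ball 0 1" "holo_disc \<phi>" "\<phi> ` ball 0 1 \<subseteq> D" "\<phi> 0 = z" "\<phi> t = w"
proof -
  obtain g where g: "polynomial_function g" "path_image g \<subseteq> D" "pathstart g = z" "pathfinish g = w"
    using connected_open_polynomial_connected[of D z w] D z w by (auto simp: domain_def)
  obtain \<Phi> where \<Phi>: "\<And>i. (\<lambda>\<zeta>. \<Phi> \<zeta> $ i) holomorphic_on UNIV" "\<And>t. \<Phi> (of_real t) = g t"
    using polynomial_function_complexification[OF g(1)] by blast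
  have "continuous_on UNIV \<Phi>"
    by (intro continuous_on_vec_componentwise holomorphic_on_imp_continuous_on \<Phi>)
  then have "open (\<Phi> -` D)" using D by (auto simp: domain_def intro: open_vimage)
  moreover define K where "K = closed_segment (0::complex) 1"
  moreover have "K \<subseteq> \<Phi> -` D"
  proof
    fix x assume "x \<in> K"
    then obtain u where u: "0 \<le> u" "u \<le> 1" "x = of_real u"
      by (auto simp: K_def closed_segment_def scaleR_conv_of_real)
    then show "x \<in> \<Phi> -` D" using g(2) \<Phi>(2) by (auto simp: path_image_def)
  qed
  ultimately obtain e where e: "e > 0" "{x. infdist x K \<le> e} \<subseteq> \<Phi> -` D"
    using compact_in_open_separated[of K "\<Phi> -` D"] by (auto simp: K_def)
  \<comment> \<open>Convex neighbourhood of the segment that the entire curve maps into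
    \<open>D\<close>. Being bounded, it is not the whole plane, so the Riemann mapping theorem
    identifies it with the disc.\<close>
  define S where "S = (\<Union>x\<in>K. \<Union>y\<in>ball 0 e. {x + y})"
  have S: "open S" "simply_connected S"
    unfolding S_def K_def by (intro open_sums convex_imp_simply_connected convex_sums; simp)+
  have "x \<in> S" if "x \<in> K" for x using e(1) that unfolding S_def by (intro UN_I[of x] UN_I[of 0]) auto
  then have S01: "0 \<in> S" "1 \<in> S" by (simp_all add: K_def)
  have "bounded S" unfolding S_def by (intro bounded_plus[unfolded set_plus_def] bounded_sums) (auto simp: K_def intro: compact_imp_bounded)
  then have "S \<noteq> UNIV" by auto
  then obtain f h where fh: "f holomorphic_on S" "h holomorphic_on ball 0 1"
      "\<And>z. z \<in> S \<Longrightarrow> f z \<in> ball 0 1 \<and> h (f z) = z" "\<And>z. z \<in> ball 0 1 \<Longrightarrow> h z \<in> S"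
    using S S01 unfolding simply_connected_eq_biholomorphic_to_disc[OF S(1)] by blast
  have SD: "\<Phi> x \<in> D" if x: "x \<in> S" for x
  proof -
    obtain k y where "k \<in> K" "y \<in> ball 0 e" "x = k + y"
      using x unfolding S_def by blast
    then have "infdist x K \<le> e" by (intro infdist_le2[of k]) (auto simp: dist_norm)
    then show ?thesis using e(2) by blast
  qed
  define a b where "a = f 0" "b = f 1"
  have ab: "cmod a < 1" "cmod b < 1" using fh(3) S01 by (auto simp: a_b_def)
  \<comment> \<open>Disc automorphism carrying 0 to \<open>f 0\<close>, so that the composed disc
    starts at \<open>z\<close>; \<open>t\<close> will be the parameter that it sends to
    \<open>f 1\<close>.\<close>
  define m where "m = Moebius_function 0 (- a)"
  have m: "m holomorphic_on ball 0 1" "m ` ball 0 1 \<subseteq> ball 0 1"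
    unfolding m_def using ab Moebius_function_norm_lt_1[of "-a"] by (auto intro: Moebius_function_holomorphic)
  define t where "t = Moebius_function 0 a b"
  show ?thesis
  proof (rule that[of t "\<lambda>\<zeta>. \<Phi> (h (m \<zeta>))"])
    show "t \<in> ball 0 1" using Moebius_function_norm_lt_1[OF ab] by (simp add: t_def)
    show "holo_disc (\<lambda>\<zeta>. \<Phi> (h (m \<zeta>)))"
      unfolding holo_disc_def
      using holomorphic_on_compose_gen[OF holomorphic_on_compose_gen[OF m(1) fh(2) m(2)] \<Phi>(1)]
      by (simp add: o_def)
    show "(\<lambda>\<zeta>. \<Phi> (h (m \<zeta>))) ` ball 0 1 \<subseteq> D" using SD fh(4) m(2) by (auto simp: image_subset_iff)
    have "m 0 = a" by (simp add: m_def Moebius_function_of_zero)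
    then have "h (m 0) = 0" using fh(3)[OF S01(1)] by (simp add: a_b_def)
    then show "\<Phi> (h (m 0)) = z" using \<Phi>(2)[of 0] g(3) by (simp add: pathstart_def)
    have "m t = b" unfolding m_def t_def by (rule Moebius_function_compose) (use ab in auto)
    then have "h (m t) = 1" using fh(3)[OF S01(2)] by (simp add: a_b_def)
    then show "\<Phi> (h (m t)) = w" using \<Phi>(2)[of 1] g(4) by (simp add: pathfinish_def)
  qed
qed

section \<open>Bounds for the Lempert function and the Kobayashi distance\<close>

lemma lempert_ge:
  assumes D: "domain D" and z: "z \<in> D" and w: "w \<in> D"
    and f: "holo_fun_on f D" "f ` D \<subseteq> ball 0 1"
  shows "cmod (f z - f w) / 4 \<le> lempert D z w"
  unfolding lempert_def
proof (rule cInf_greatest)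
  show "{poincare 0 t | t \<phi>. t \<in> ball 0 1 \<and> holo_disc \<phi> \<and> \<phi> ` ball 0 1 \<subseteq> D \<and> \<phi> 0 = z \<and> \<phi> t = w} \<noteq> {}"
    using domain_holo_disc_through[OF D z w] by (smt (verit) Collect_empty_eq)
next
  fix x assume "x \<in> {poincare 0 t | t \<phi>. t \<in> ball 0 1 \<and> holo_disc \<phi> \<and> \<phi> ` ball 0 1 \<subseteq> D \<and> \<phi> 0 = z \<and> \<phi> t = w}"
  then obtain t \<phi> where *: "x = poincare 0 t" "t \<in> ball 0 1" "holo_disc \<phi>" "\<phi> ` ball 0 1 \<subseteq> D" "\<phi> 0 = z" "\<phi> t = w"
    by blast
  have "cmod (f (\<phi> 0) - f (\<phi> t)) / 4 \<le> artanh (cmod t)"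
    by (rule holomorphic_disc_dist_bound[where h = "\<lambda>\<zeta>. f (\<phi> \<zeta>)"])
       (use holo_fun_on_comp_disc[OF f(1) *(3,4)] *(2,4) f(2) in \<open>auto simp: image_subset_iff\<close>)
  then show "cmod (f z - f w) / 4 \<le> x" using * by (simp add: poincare_0_left)
qed

lemma lempert_le:
  assumes "t \<in> ball 0 1" "holo_disc \<phi>" "\<phi> ` ball 0 1 \<subseteq> D"
  shows "lempert D (\<phi> 0) (\<phi> t) \<le> artanh (cmod t)"
  unfolding lempert_def
proof (rule cInf_lower)
  show "artanh (cmod t) \<in> {poincare 0 s | s \<psi>. s \<in> ball 0 1 \<and> holo_disc \<psi> \<and> \<psi> ` ball 0 1 \<subseteq> D \<and> \<psi> 0 = \<phi> 0 \<and> \<psi> s = \<phi> t}"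
    using assms by (auto simp flip: poincare_0_left)
  show "bdd_below {poincare 0 s | s \<psi>. s \<in> ball 0 1 \<and> holo_disc \<psi> \<and> \<psi> ` ball 0 1 \<subseteq> D \<and> \<psi> 0 = \<phi> 0 \<and> \<psi> s = \<phi> t}"
    by (rule bdd_belowI[of _ 0]) (auto simp: poincare_0_left intro: artanh_nonneg)
qed

text \<open>The affine disc centred at \<open>z\<close> that reaches \<open>w\<close> at parameter
  \<open>t\<close> has radius \<open>norm (w - z) / t < r\<close>. So points that are close compared
  with the size of a ball in \<open>D\<close> have a small Lempert value.\<close>

lemma lempert_le_ball:
  fixes z w :: "complex ^ 'n"
  assumes t: "0 < t" "t < 1" and zw: "norm (w - z) < t * r" and r: "ball z r \<subseteq> D"
  shows "lempert D z w \<le> artanh t"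
proof -
  define \<phi> where "\<phi> \<zeta> = z + (\<zeta> / of_real t) *s (w - z)" for \<zeta>
  have hol: "holo_disc \<phi>" unfolding holo_disc_def \<phi>_def
    using t by (auto intro!: holomorphic_intros)
  have "\<phi> ` ball 0 1 \<subseteq> D"
  proof safe
    fix \<zeta> :: complex assume "\<zeta> \<in> ball 0 1"
    then have "norm ((\<zeta> / of_real t) *s (w - z)) \<le> 1 / t * norm (w - z)"
      unfolding norm_vector_smult using t by (intro mult_right_mono) (auto simp: norm_divide divide_right_mono)
    also have "\<dots> < r" using zw t by (simp add: field_simps)
    finally have "\<phi> \<zeta> \<in> ball z r" by (simp add: \<phi>_def dist_norm del: vector_ssub_ldistrib)
    then show "\<phi> \<zeta> \<in> D" using r by blast
  qed
  then have "lempert D (\<phi> 0) (\<phi> (of_real t)) \<le> artanh (cmod (of_real t))"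
    by (intro lempert_le hol) (use t in auto)
  moreover have "\<phi> 0 = z" "\<phi> (of_real t) = w" using t by (auto simp: \<phi>_def vec_eq_iff)
  ultimately show ?thesis using t by simp
qed

text \<open>The Euclidean lower bound of each link adds up along the chain by telescoping and the
  triangle inequality in the plane.\<close>

lemma kobayashi_ge:
  assumes D: "domain D" and z: "z \<in> D" and w: "w \<in> D"
    and f: "holo_fun_on f D" "f ` D \<subseteq> ball 0 1"
  shows "cmod (f z - f w) / 4 \<le> kobayashi D z w"
  unfolding kobayashi_def
proof (rule cInf_greatest)
  have "(\<Sum>j<1. lempert D ((\<lambda>j. if j = 0 then z else w) j) ((\<lambda>j. if j = 0 then z else w) (Suc j)))
    \<in> {(\<Sum>j<n. lempert D (p j) (p (Suc j))) | n p. p 0 = z \<and> p n = w \<and> (\<forall>j\<le>n. p j \<in> D)}"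
    using z w by (intro CollectI exI[of _ "1::nat"] exI[of _ "\<lambda>j::nat. if j = 0 then z else w"]) auto
  then show "{(\<Sum>j<n. lempert D (p j) (p (Suc j))) | n p. p 0 = z \<and> p n = w \<and> (\<forall>j\<le>n. p j \<in> D)} \<noteq> {}"
    by blast
next
  fix x assume "x \<in> {(\<Sum>j<n. lempert D (p j) (p (Suc j))) | n p. p 0 = z \<and> p n = w \<and> (\<forall>j\<le>n. p j \<in> D)}"
  then obtain n p where p: "x = (\<Sum>j<n. lempert D (p j) (p (Suc j)))" "p 0 = z" "p n = w" "\<forall>j\<le>n. p j \<in> D"
    by blast
  have "f z - f w = (\<Sum>j<n. f (p j) - f (p (Suc j)))"
    using sum_lessThan_telescope'[of "\<lambda>j. f (p j)" n] p by simp
  then have "cmod (f z - f w) \<le> (\<Sum>j<n. cmod (f (p j) - f (p (Suc j))))" by (simp add: norm_sum)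
  then have "cmod (f z - f w) / 4 \<le> (\<Sum>j<n. cmod (f (p j) - f (p (Suc j))) / 4)"
    by (simp flip: sum_divide_distrib)
  also have "\<dots> \<le> x" unfolding p(1)
    by (intro sum_mono lempert_ge[OF D _ _ f]) (use p(4) in auto)
  finally show "cmod (f z - f w) / 4 \<le> x" .
qed

lemma lempert_nonneg: "domain D \<Longrightarrow> z \<in> D \<Longrightarrow> w \<in> D \<Longrightarrow> 0 \<le> lempert D z w"
  using lempert_ge[of D z w, OF _ _ _ holo_fun_on_const[of 0]] by force

text \<open>Three links because the large disc passes through \<open>ws n\<close> and not through
  \<open>w\<close>: one to \<open>ws n\<close>, one along the flow, one from
  \<open>X 1 (ws n)\<close> to \<open>X 1 w\<close>.\<close>

lemma kobayashi_le_three: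
  assumes D: "domain D" and p: "p0 \<in> D" "p1 \<in> D" "p2 \<in> D" "p3 \<in> D"
  shows "kobayashi D p0 p3 \<le> lempert D p0 p1 + lempert D p1 p2 + lempert D p2 p3"
  unfolding kobayashi_def
proof (rule cInf_lower)
  define q where "q j = [p0, p1, p2, p3] ! j" for j
  have "lempert D p0 p1 + lempert D p1 p2 + lempert D p2 p3 = (\<Sum>j<3. lempert D (q j) (q (Suc j)))"
    by (simp add: q_def eval_nat_numeral)
  moreover have "q 0 = p0" "q 3 = p3" by (simp_all add: q_def)
  moreover have "\<forall>j\<le>3. q j \<in> D"
    using p by (auto simp: q_def eval_nat_numeral le_Suc_eq)
  ultimately show "lempert D p0 p1 + lempert D p1 p2 + lempert D p2 p3 \<in>
     {(\<Sum>j<n. lempert D (p j) (p (Suc j))) | n p. p 0 = p0 \<and> p n = p3 \<and> (\<forall>j\<le>n. p j \<in> D)}"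
    by blast
  show "bdd_below {(\<Sum>j<n. lempert D (p j) (p (Suc j))) | n p. p 0 = p0 \<and> p n = p3 \<and> (\<forall>j\<le>n. p j \<in> D)}"
    by (rule bdd_belowI[of _ 0]) (auto intro!: sum_nonneg lempert_nonneg[OF D])
qed

text \<open>Liouville's argument made quantitative: on the flow disc of radius \<open>1 + r\<close>
  at \<open>ws n\<close>, one unit of time changes \<open>f\<close> by at most \<open>M / r\<close>.
  First \<open>n\<close> tends to infinity, then \<open>r\<close>.\<close>

lemma holo_fun_eq_along_limit_orbit:
  fixes V :: "complex ^ 'n \<Rightarrow> complex ^ 'n"
  assumes V: "holo_map_on V UNIV" and X: "is_complex_flow V X"
    and D: "open D" and w: "w \<in> D" "X 1 w \<in> D" and ws: "ws \<longlonglongrightarrow> w"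
    and disc: "\<And>R. \<forall>\<^sub>F n in sequentially. \<forall>\<sigma>. cmod \<sigma> \<le> R \<longrightarrow> X \<sigma> (ws n) \<in> D"
    and f: "holo_fun_on f D" and bdd: "\<And>z. z \<in> D \<Longrightarrow> cmod (f z) \<le> M"
  shows "f (X 1 w) = f w"
proof -
  have cont: "continuous_on D f" by (rule holo_fun_on_imp_continuous_on[OF f])
  have lim: "(\<lambda>n. cmod (f (X 1 (ws n)) - f (ws n))) \<longlonglongrightarrow> cmod (f (X 1 w) - f w)"
    using cont D w flow_tendsto[OF V X ws, of 1] ws
    by (intro tendsto_intros) (metis continuous_on_eq_continuous_at isCont_tendsto_compose)+
  have bound: "cmod (f (X 1 w) - f w) \<le> M / r" if r: "r > 0" for r
  proof (rule tendsto_upperbound[OF lim])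
    show "\<forall>\<^sub>F n in sequentially. cmod (f (X 1 (ws n)) - f (ws n)) \<le> M / r"
      using disc[of "1 + r"]
    proof eventually_elim
      case (elim n)
      have "cmod (f (X 1 (ws n)) - f (X 0 (ws n))) \<le> M / r"
      proof (rule holomorphic_unit_step_bound[where S = "cball 0 (1 + r)" and g = "\<lambda>\<sigma>. f (X \<sigma> (ws n))"])
        have "(\<lambda>\<sigma>. f (X \<sigma> (ws n))) field_differentiable at \<sigma>" if "\<sigma> \<in> cball 0 (1 + r)" for \<sigma>
          by (rule holo_fun_on_comp_curve[OF f _ flow_has_derivative[OF X]]) (use elim that in auto)
        then show "(\<lambda>\<sigma>. f (X \<sigma> (ws n))) holomorphic_on cball 0 (1 + r)"
          by (simp add: holomorphic_on_def field_differentiable_at_within)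
        show "cball z r \<subseteq> cball 0 (1 + r)" if "z \<in> closed_segment 0 1" for z :: complex
        proof -
          have "cmod z \<le> 1" using segment_bound1[OF that] by simp
          then show ?thesis by (auto simp: dist_norm cball_subset_cball_iff)
        qed
      qed (use r elim bdd in auto)
      then show ?case by (simp add: flow_zero[OF X])
    qed
  qed simp
  have "((\<lambda>r. M / r) \<longlongrightarrow> 0) at_top" by (rule tendsto_divide_0[OF tendsto_const filterlim_at_top_imp_at_infinity[OF filterlim_ident]])
  moreover have "\<forall>\<^sub>F r in at_top. cmod (f (X 1 w) - f w) \<le> M / r"
    by (rule eventually_mono[OF eventually_gt_at_top[of 0] bound])
  ultimately have "cmod (f (X 1 w) - f w) \<le> 0"
    by (rule tendsto_lowerbound) simp
  then show ?thesis by simp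
qed

text \<open>For each \<open>t\<close> between 0 and 1 a suitable \<open>n\<close> makes every link
  cost at most \<open>artanh t\<close>: the flow disc of radius \<open>1 / t\<close>, rescaled to
  the unit disc, reaches time 1 at parameter \<open>t\<close>, and the end links use affine discs in
  balls of fixed size.\<close>

lemma kobayashi_limit_orbit_eq_0:
  fixes V :: "complex ^ 'n \<Rightarrow> complex ^ 'n"
  assumes V: "holo_map_on V UNIV" and X: "is_complex_flow V X"
    and D: "domain D" and w: "w \<in> D" "X 1 w \<in> D" and ws: "ws \<longlonglongrightarrow> w"
    and disc: "\<And>R. \<forall>\<^sub>F n in sequentially. \<forall>\<sigma>. cmod \<sigma> \<le> R \<longrightarrow> X \<sigma> (ws n) \<in> D"
  shows "kobayashi D w (X 1 w) = 0"
proof -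
  have oD: "open D" using D by (simp add: domain_def)
  obtain r1 where r1: "r1 > 0" "ball w r1 \<subseteq> D" using oD w(1) open_contains_ball by blast
  obtain r2 where r2: "r2 > 0" "ball (X 1 w) r2 \<subseteq> D" using oD w(2) open_contains_ball by blast
  have bound: "kobayashi D w (X 1 w) \<le> 3 * artanh t" if t: "0 < t" "t < 1" for t
  proof -
    have "\<forall>\<^sub>F n in sequentially. dist (ws n) w < t * r1"
      by (rule tendstoD[OF ws]) (use t r1 in simp)
    \<comment> \<open>The affine disc of the last link is centred at \<open>X 1 (ws n)\<close>, not
      at \<open>X 1 w\<close>; halving \<open>r2\<close> leaves room for this shift.\<close>
    moreover have "\<forall>\<^sub>F n in sequentially. dist (X 1 (ws n)) (X 1 w) < t * (r2 / 2)"
      by (rule tendstoD[OF flow_tendsto[OF V X ws]]) (use t r2 in simp)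
    ultimately have "\<forall>\<^sub>F n in sequentially. dist (ws n) w < t * r1 \<and> dist (X 1 (ws n)) (X 1 w) < t * (r2 / 2) \<and>
        (\<forall>\<sigma>. cmod \<sigma> \<le> 1 / t \<longrightarrow> X \<sigma> (ws n) \<in> D)"
      using disc[of "1 / t"] by eventually_elim auto
    then obtain n where n: "dist (ws n) w < t * r1" "dist (X 1 (ws n)) (X 1 w) < t * (r2 / 2)"
        "\<And>\<sigma>. cmod \<sigma> \<le> 1 / t \<Longrightarrow> X \<sigma> (ws n) \<in> D"
      by (auto dest: eventually_happens)
    have in1: "ws n \<in> D" using n(3)[of 0] t by (simp add: flow_zero[OF X])
    have in2: "X 1 (ws n) \<in> D" using n(3)[of 1] t by simp
    have "lempert D w (ws n) \<le> artanh t"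
      by (rule lempert_le_ball[OF t _ r1(2)]) (use n(1) in \<open>simp add: dist_norm\<close>)
    moreover have "lempert D (X 1 (ws n)) (X 1 w) \<le> artanh t"
    proof (rule lempert_le_ball[OF t])
      show "norm (X 1 w - X 1 (ws n)) < t * (r2 / 2)" using n(2) by (simp add: dist_norm norm_minus_commute)
      have "t * (r2 / 2) \<le> r2 / 2" using t r2 by simp
      then have "dist (X 1 (ws n)) (X 1 w) < r2 / 2" using n(2) by simp
      then have "ball (X 1 (ws n)) (r2 / 2) \<subseteq> ball (X 1 w) r2" by (simp add: ball_subset_ball_iff)
      then show "ball (X 1 (ws n)) (r2 / 2) \<subseteq> D" using r2(2) by blast
    qed
    moreover have "lempert D (ws n) (X 1 (ws n)) \<le> artanh t"
    proof -
      define \<phi> where "\<phi> \<zeta> = X (\<zeta> / of_real t) (ws n)" for \<zeta>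
      have "holo_disc \<phi>"
        unfolding holo_disc_def \<phi>_def
      proof
        fix i
        have "(\<lambda>\<sigma>. X \<sigma> (ws n) $ i) holomorphic_on UNIV"
          using flow_has_derivative[OF X]
          by (auto simp: has_derivative_curve_iff holomorphic_on_def field_differentiable_def)
        then have "((\<lambda>\<sigma>. X \<sigma> (ws n) $ i) \<circ> (\<lambda>\<zeta>. \<zeta> / of_real t)) holomorphic_on ball 0 1"
          by (intro holomorphic_on_compose_gen[where t = UNIV] holomorphic_intros) (use t in auto)
        then show "(\<lambda>\<zeta>. X (\<zeta> / of_real t) (ws n) $ i) holomorphic_on ball 0 1" by (simp add: o_def)
      qed
      moreover have "\<phi> ` ball 0 1 \<subseteq> D"
        using n(3) t by (auto simp: \<phi>_def norm_divide divide_right_mono)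
      ultimately have "lempert D (\<phi> 0) (\<phi> (of_real t)) \<le> artanh (cmod (of_real t))"
        by (intro lempert_le) (use t in auto)
      then show ?thesis using t by (simp add: \<phi>_def flow_zero[OF X])
    qed
    ultimately show ?thesis
      using kobayashi_le_three[OF D w(1) in1 in2 w(2)] by linarith
  qed
  have "((\<lambda>t. 3 * artanh t) \<longlongrightarrow> 3 * artanh (0::real)) (at_right 0)"
    by (intro tendsto_intros) auto
  then have "kobayashi D w (X 1 w) \<le> 3 * artanh 0"
  proof (rule tendsto_lowerbound)
    show "\<forall>\<^sub>F t in at_right 0. kobayashi D w (X 1 w) \<le> 3 * artanh t"
      by (rule eventually_at_rightI[of 0 1]) (auto intro: bound)
  qed simp
  moreover have "0 \<le> kobayashi D w (X 1 w)"
    using kobayashi_ge[OF D w holo_fun_on_const[of 0]] by force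
  ultimately show ?thesis by simp
qed

section \<open>Bounded domains\<close>

lemma bounded_domain_separating_function:
  fixes D :: "(complex ^ 'n) set"
  assumes "bounded D" "z \<noteq> w"
  obtains f where "holo_fun_on f D" "f ` D \<subseteq> ball 0 1" "f z \<noteq> f w"
proof -
  obtain R where R: "R > 0" "\<And>z. z \<in> D \<Longrightarrow> norm z < R"
    using assms(1) bounded_pos_less by blast
  obtain i where i: "z $ i \<noteq> w $ i" using assms(2) by (auto simp: vec_eq_iff)
  show ?thesis
  proof (rule that[of "\<lambda>z. of_real (1 / R) * z $ i"])
    have "cmod (y $ i) < R" if "y \<in> D" for y
      using Finite_Cartesian_Product.norm_nth_le[of y i] R(2)[OF that] by simp
    then show "(\<lambda>z. of_real (1 / R) * z $ i) ` D \<subseteq> ball 0 1"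
      using R by (auto simp: norm_divide)
    show "holo_fun_on (\<lambda>z. of_real (1 / R) * z $ i) D" by (rule holo_fun_on_coord_scale)
  qed (use i R in auto)
qed

text \<open>Comparing an element with a real \<open>Sup\<close> requires an upper bound for the set;
  one holomorphic disc through the two points provides it by Schwarz-Pick.\<close>

lemma caratheodory_ge:
  assumes D: "domain D" and z: "z \<in> D" and w: "w \<in> D"
    and f: "holo_fun_on f D" "f ` D \<subseteq> ball 0 1"
  shows "poincare (f z) (f w) \<le> caratheodory D z w"
  unfolding caratheodory_def
proof (rule cSup_upper)
  obtain t \<phi> where \<phi>: "t \<in> ball 0 1" "holo_disc \<phi>" "\<phi> ` ball 0 1 \<subseteq> D" "\<phi> 0 = w" "\<phi> t = z"
    using domain_holo_disc_through[OF D w z] by blast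
  have "poincare (g z) (g w) \<le> artanh (cmod t)" if "holo_fun_on g D" "g ` D \<subseteq> ball 0 1" for g
    using Schwarz_Pick_poincare[OF holo_fun_on_comp_disc[OF that(1) \<phi>(2,3)] _ \<phi>(1)] \<phi> that(2)
    by (auto simp: image_subset_iff)
  then show "bdd_above {poincare (f z) (f w) | f. holo_fun_on f D \<and> f ` D \<subseteq> ball 0 1}"
    by (intro bdd_aboveI[of _ "artanh (cmod t)"]) auto
qed (use f in auto)

lemma psh_on_norm_sq: "psh_on D (\<lambda>z :: complex ^ 'n. (norm z)\<^sup>2)"
  unfolding psh_on_def subharmonic_on_def
proof (intro conjI allI ballI)
  show "continuous_on D (\<lambda>z :: complex ^ 'n. (norm z)\<^sup>2)" by (intro continuous_intros)
  fix a b :: "complex ^ 'n"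
  show "continuous_on {\<zeta>. a + \<zeta> *s b \<in> D} (\<lambda>\<zeta>. (norm (a + \<zeta> *s b))\<^sup>2)"
    by (intro continuous_intros continuous_on_affine_curve)
  fix c assume "c \<in> {\<zeta>. a + \<zeta> *s b \<in> D}"
  show "\<exists>R>0. \<forall>r. 0 < r \<and> r < R \<longrightarrow> (norm (a + c *s b))\<^sup>2 \<le>
      integral {0..2*pi} (\<lambda>\<theta>. (norm (a + (c + of_real r * cis \<theta>) *s b))\<^sup>2) / (2*pi)"
  proof (intro exI[of _ 1] conjI allI impI)
    fix r :: real assume r: "0 < r \<and> r < 1"
    have "integral {0..2*pi} (\<lambda>\<theta>. (norm (a + (c + of_real r * cis \<theta>) *s b - (a + c *s b)))\<^sup>2) \<ge> 0"
      by (intro integral_nonneg integrable_continuous_real continuous_intros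
          continuous_on_compose2[OF continuous_on_affine_curve[where S = UNIV]]) auto
    moreover have "integral {0..2*pi} (\<lambda>\<theta>. (norm (a + (c + of_real r * cis \<theta>) *s b))\<^sup>2) =
       2 * pi * (norm (a + c *s b))\<^sup>2 +
       integral {0..2*pi} (\<lambda>\<theta>. (norm (a + (c + of_real r * cis \<theta>) *s b - (a + c *s b)))\<^sup>2)"
      by (rule holomorphic_curve_circle_mean_norm_sq[where F = "\<lambda>\<zeta>. a + \<zeta> *s b"])
         (use r in \<open>auto intro!: holomorphic_intros\<close>)
    ultimately show "(norm (a + c *s b))\<^sup>2 \<le>
      integral {0..2*pi} (\<lambda>\<theta>. (norm (a + (c + of_real r * cis \<theta>) *s b))\<^sup>2) / (2*pi)"
      by (simp add: pos_le_divide_eq mult.commute)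
  qed simp
qed

lemma psh_on_zero: "psh_on D (\<lambda>z. 0)"
  unfolding psh_on_def subharmonic_on_def by (auto intro!: exI[of _ "1::real"])

text \<open>For \<open>(norm z)\<^sup>2\<close> with \<open>\<epsilon> = 1\<close> the function
  tested for strictness is 0; boundedness of \<open>D\<close> makes \<open>(norm z)\<^sup>2\<close>
  bounded above.\<close>

lemma bounded_imp_core_empty:
  assumes "open D" "bounded D"
  shows "core D = {}"
proof -
  have "strictly_psh_at D (\<lambda>z. (norm z)\<^sup>2) \<zeta>" if "\<zeta> \<in> D" for \<zeta>
    unfolding strictly_psh_at_def
    by (intro exI[of _ D] exI[of _ "1::real"]) (use that assms psh_on_zero in simp)
  moreover have "bdd_above ((\<lambda>z. (norm z)\<^sup>2) ` D)"
  proof -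
    obtain R where "\<And>z. z \<in> D \<Longrightarrow> norm z \<le> R" using assms(2) unfolding bounded_iff by blast
    then show ?thesis by (intro bdd_aboveI2[where M = "R\<^sup>2"] power_mono) auto
  qed
  ultimately show ?thesis
    unfolding core_def using psh_on_norm_sq[of D] by (auto simp: psh_on_def)
qed

lemma bounded_imp_hyperbolic:
  assumes D: "domain D" "bounded D"
  shows "kobayashi_hyperbolic D" "caratheodory_hyperbolic D"
proof -
  have "kobayashi D z w \<noteq> 0 \<and> caratheodory D z w \<noteq> 0" if zw: "z \<in> D" "w \<in> D" "z \<noteq> w" for z w
  proof -
    obtain f where f: "holo_fun_on f D" "f ` D \<subseteq> ball 0 1" "f z \<noteq> f w"
      using bounded_domain_separating_function[OF D(2) zw(3)] by blast
    have "kobayashi D z w > 0"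
      using kobayashi_ge[OF D(1) zw(1,2) f(1,2)] f(3) by (smt (verit) zero_less_norm_iff divide_pos_pos right_minus_eq)
    moreover have "poincare (f z) (f w) > 0"
      by (rule poincare_pos) (use f zw in \<open>auto simp: image_subset_iff\<close>)
    then have "caratheodory D z w > 0" using caratheodory_ge[OF D(1) zw(1,2) f(1,2)] by simp
    ultimately show ?thesis by simp
  qed
  then show "kobayashi_hyperbolic D" "caratheodory_hyperbolic D"
    unfolding kobayashi_hyperbolic_def caratheodory_hyperbolic_def by blast+
qed

lemma bounded_imp_biholo_to_bounded:
  assumes "domain D" "bounded D"
  shows "biholo_to_bounded D"
proof -
  have "holo_map_on (\<lambda>z. z) D"
    unfolding holo_map_on_def
  proof
    show "holo_fun_on (\<lambda>z. z $ i) D" for i using holo_fun_on_coord_scale[of 1 i D] by simp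
  qed
  then show ?thesis
    unfolding biholo_to_bounded_def using assms
    by (intro exI[of _ "\<lambda>z. z"] exI[of _ D]) auto
qed

theorem theorem1p1:
  fixes V :: "complex ^ 'n \<Rightarrow> complex ^ 'n"
    and X :: "complex \<Rightarrow> complex ^ 'n \<Rightarrow> complex ^ 'n"
    and D :: "(complex ^ 'n) set"
  assumes "holo_map_on V UNIV"
    and "complete_vf V"
    and "is_complex_flow V X"
    and "globally_asymptotically_stable V X"
    and "domain D" and "0 \<in> D"
    and "spirallike X D" and "circularlike X D"
  shows "(bounded D \<longleftrightarrow> biholo_to_bounded D) \<and>
         (bounded D \<longleftrightarrow> kobayashi_hyperbolic D) \<and>
         (bounded D \<longleftrightarrow> core D = {}) \<and>
         (bounded D \<longleftrightarrow> caratheodory_hyperbolic D)"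
proof -
  note V = assms(1) and X = assms(3) and D = assms(5)
  have oD: "open D" using D by (simp add: domain_def)
  have lim: "((\<lambda>t. X (of_real t) z) \<longlongrightarrow> 0) at_top" for z
    using assms(4) by (simp add: globally_asymptotically_stable_def)
  \<comment> \<open>One limit point refutes all four properties: the pair \<open>w\<close>,
    \<open>X 1 w\<close> defeats both hyperbolicities and the bounded model, and \<open>w\<close>
    lies in the core.\<close>
  have unbounded: "\<not> biholo_to_bounded D \<and> \<not> kobayashi_hyperbolic D \<and> core D \<noteq> {} \<and> \<not> caratheodory_hyperbolic D"
    if unb: "\<not> bounded D"
  proof -
    obtain w ws where w: "w \<in> D" "w \<noteq> 0" and ws: "ws \<longlonglongrightarrow> w" and
      disc: "\<And>R. \<forall>\<^sub>F n in sequentially. \<forall>\<sigma>. cmod \<sigma> \<le> R \<longrightarrow> X \<sigma> (ws n) \<in> D"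
      using unbounded_exhausting_discs[OF V X lim oD assms(6-8) unb] by blast
    have w1: "X 1 w \<in> D"
      by (rule spirallike_circularlike_halfplane[OF V X assms(7,8) w(1)]) simp
    have neq: "X 1 w \<noteq> w" and Vw: "V w \<noteq> 0" using attracted_not_fixed[OF V X lim w(2)] by auto
    have feq: "f (X 1 w) = f w" if "holo_fun_on f D" "\<And>z. z \<in> D \<Longrightarrow> cmod (f z) \<le> M" for f M
      by (rule holo_fun_eq_along_limit_orbit[OF V X oD w(1) w1 ws disc that])
    have "\<not> biholo_to_bounded D"
    proof
      assume "biholo_to_bounded D"
      then obtain F :: "complex ^ 'n \<Rightarrow> complex ^ 'n" and G \<Omega> where F: "bounded \<Omega>" "holo_map_on F D"
        "F ` D = \<Omega>" "\<forall>z\<in>D. G (F z) = z"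
        unfolding biholo_to_bounded_def by blast
      obtain M where M: "\<And>z. z \<in> D \<Longrightarrow> norm (F z) \<le> M"
        using F(1,3) unfolding bounded_iff by blast
      have "F (X 1 w) $ i = F w $ i" for i
      proof (rule feq[where f = "\<lambda>z. F z $ i" and M = M])
        show "cmod (F z $ i) \<le> M" if "z \<in> D" for z
          using Finite_Cartesian_Product.norm_nth_le[of "F z" i] M[OF that] by simp
      qed (use F(2) in \<open>simp add: holo_map_on_def\<close>)
      then have "F (X 1 w) = F w" by (simp add: vec_eq_iff)
      then show False using F(4) w(1) w1 neq by metis
    qed
    moreover have "\<not> kobayashi_hyperbolic D"
      using kobayashi_limit_orbit_eq_0[OF V X D w(1) w1 ws disc] w(1) w1 neq
      unfolding kobayashi_hyperbolic_def by metis
    moreover have "\<not> caratheodory_hyperbolic D"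
    proof -
      have "poincare (f w) (f (X 1 w)) = 0" if "holo_fun_on f D" "f ` D \<subseteq> ball 0 1" for f
      proof -
        have "f (X 1 w) = f w" by (rule feq[OF that(1), of 1]) (use that(2) in \<open>auto simp: image_subset_iff less_imp_le\<close>)
        then show ?thesis by (simp add: poincare_def)
      qed
      \<comment> \<open>The constant 0 makes the set nonempty, so its \<open>Sup\<close> is 0 and
        not an unspecified value.\<close>
      moreover have "holo_fun_on (\<lambda>_. 0) D" "(\<lambda>_. 0 :: complex) ` D \<subseteq> ball 0 1"
        using holo_fun_on_const by auto
      ultimately have "{poincare (f w) (f (X 1 w)) | f. holo_fun_on f D \<and> f ` D \<subseteq> ball 0 1} = {0}"
        by (auto intro!: exI[of _ "\<lambda>_. 0"])
      then have "caratheodory D w (X 1 w) = 0" by (simp add: caratheodory_def)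
      then show ?thesis using w(1) w1 neq unfolding caratheodory_hyperbolic_def by metis
    qed
    moreover have "w \<in> core D"
      unfolding core_def
    proof (intro CollectI conjI allI impI w(1))
      fix u assume u: "continuous_on D u \<and> psh_on D u \<and> bdd_above (u ` D)"
      then obtain M where M: "\<And>z. z \<in> D \<Longrightarrow> u z \<le> M" by (auto simp: bdd_above_def)
      \<comment> \<open>\<open>psh_le_along_limit_orbit\<close> speaks only of times with
        \<open>X \<sigma> w\<close> in \<open>D\<close>; openness provides a neighbourhood of 0 of
        such times, enough for a local maximum.\<close>
      have "open ((\<lambda>\<sigma>. X \<sigma> w) -` D)" by (rule open_vimage[OF oD flow_continuous_on[OF X]])
      then have "\<forall>\<^sub>F \<sigma> in nhds 0. X \<sigma> w \<in> D"
        using w(1) unfolding eventually_nhds by (auto simp: flow_zero[OF X])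
      then have "\<forall>\<^sub>F \<sigma> in nhds 0. u (X \<sigma> w) \<le> u (X 0 w)"
        unfolding flow_zero[OF X]
        by (rule eventually_mono) (rule psh_le_along_limit_orbit[OF V X oD w(1) ws disc _ M], use u in auto)
      then have "\<not> strictly_psh_at D u (X 0 w)"
        using Vw by (intro not_strictly_psh_at_if_le_along_curve[OF flow_has_derivative[OF X]])
           (simp_all add: flow_zero[OF X])
      then show "\<not> strictly_psh_at D u w" by (simp add: flow_zero[OF X])
    qed
    ultimately show ?thesis by blast
  qed
  show ?thesis
    using unbounded bounded_imp_biholo_to_bounded[OF D] bounded_imp_hyperbolic[OF D]
      bounded_imp_core_empty[OF oD] by blast
qed

end
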